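(* Let $\mathcal{M}=(S,\mathrm{Act},P)$ be an MDP, let $G\in S$ be an absorbing target state, let $\mathrm{opt}\in\{\inf,\sup\}$, and let $s_0\in S\setminus\mathrm{Avoid}^{\mathrm{opt}}_{\mathcal{M}}(G)$ be an initial state. Assume that $\mathcal{M}$ is finitely branching, univ-decisive w.r.t. $G$ from $s_0$, and non-fleeing w.r.t. $G$ (from $s_0$). Then the second approximation scheme converges on $\mathcal{M}$ from $s_0$: for every $\epsilon>0$ there exists $n\in\mathbb{N}$ such that $|q_n^{\mathrm{opt},+}-q_n^{\mathrm{opt},-}|\le\epsilon$, where $$q_n^{\mathrm{opt},-}=\mathbb{P}^{\mathrm{opt}}_{\mathcal{M}^{\mathrm{opt}}_n,s_0}(\mathbf{F}G),\qquad q_n^{\mathrm{opt},+}=\mathbb{P}^{\mathrm{opt}}_{\mathcal{M}^{\mathrm{opt}}_n,s_0}\big(\mathbf{F}(G\vee s_\bot^n)\big).$$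
   Context: An MDP is a tuple $\mathcal{M}=(S,\mathrm{Act},P)$ with $S$, $\mathrm{Act}$ countable and $P:S\times\mathrm{Act}\times S\to[0,1]\cap\mathbb{Q}$ with $\sum_{s'}P(s,a,s')\in\{0,1\}$ for all $(s,a)$. Action $a$ is enabled at $s$ if this sum is $1$; every state has at least one enabled action. $\mathcal{M}$ is finitely branching if every state has finitely many enabled actions and every $P(s,a,\cdot)$ has finite support. A state $s$ is absorbing if $P(s,a,s)=1$ for all enabled $a$. Schedulers map finite histories of states to probability distributions over actions enabled in the last state; $\mathrm{Sched}(\mathcal{M})$ is the set of all schedulers. Pure and positional schedulers are functions $\sigma:S\to\mathrm{Act}$ choosing an enabled action. $\mathbb{P}^\sigma_{\mathcal{M},s}$ is the induced measure on infinite paths from $s$, and $\mathbb{P}^{\mathrm{opt}}_{\mathcal{M},s}(E)=\mathrm{opt}_{\sigma\in\mathrm{Sched}(\mathcal{M})}\mathbb{P}^\sigma_{\mathcal{M},s}(E)$. $\mathbf{F}\psi$ is the event that some state of the path satisfies $\psi$. Avoid sets: $\mathrm{Avoid}^{\mathrm{opt}}_{\mathcal{M}}(G)=\{s\mid\mathbb{P}^{\mathrm{opt}}_{\mathcal{M},s}(\mathbf{F}G)=0\}$ for $\mathrm{opt}\in\{\inf,\sup\}$, and $\mathrm{Avoid}^{\sigma}_{\mathcal{M}}(G)=\{s\mid\mathbb{P}^\sigma_{\mathcal{M},s}(\mathbf{F}G)=0\}$ for pure positional $\sigma$. $\mathcal{M}$ is univ-decisive w.r.t. $G$ from $s$ if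 for all pure positional $\sigma$, $\mathbb{P}^\sigma_{\mathcal{M},s}(\mathbf{F}G\vee\mathbf{F}\,\mathrm{Avoid}^\sigma_{\mathcal{M}}(G))=1$. Collapsed MDP: $\mathcal{M}^{\mathrm{opt}}=(S^{\mathrm{opt}},\mathrm{Act},P^{\mathrm{opt}})$, $S^{\mathrm{opt}}=(S\setminus\mathrm{Avoid}^{\mathrm{opt}}_{\mathcal{M}}(G))\cup\{\bot^{\mathrm{opt}}\}$ with $\bot^{\mathrm{opt}}$ fresh; for $s,s'\neq\bot^{\mathrm{opt}}$, $P^{\mathrm{opt}}(s,a,s')=P(s,a,s')$ and $P^{\mathrm{opt}}(s,a,\bot^{\mathrm{opt}})=\sum_{s'\in\mathrm{Avoid}^{\mathrm{opt}}_{\mathcal{M}}(G)}P(s,a,s')$; $P^{\mathrm{opt}}(\bot^{\mathrm{opt}},a,\bot^{\mathrm{opt}})=1$ for all $a\in\mathrm{Act}$. Sliced MDP: let $R_n^{\mathrm{opt}}$ be the set of states of $\mathcal{M}^{\mathrm{opt}}$ reachable from $s_0$ with positive probability in at most $n$ steps: $R_0^{\mathrm{opt}}=\{s_0\}$, $R_{n+1}^{\mathrm{opt}}=R_n^{\mathrm{opt}}\cup\{s'\mid\exists s\in R_n^{\mathrm{opt}},\exists a,\ P^{\mathrm{opt}}(s,a,s')>0\}$. $\mathcal{M}^{\mathrm{opt}}_n$ has state space $R_n^{\mathrm{opt}}\cup\{s_\bot^n\}$ with $s_\bot^n$ fresh; transitions between states of $R_n^{\mathrm{opt}}$ are as in $\mathcal{M}^{\mathrm{opt}}$;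 for $s\in R_n^{\mathrm{opt}}$, the probability of going from $s$ to $s_\bot^n$ under $a$ is $\sum_{s'\notin R_n^{\mathrm{opt}}}P^{\mathrm{opt}}(s,a,s')$; $s_\bot^n$ has a probability-1 self-loop for all $a\in\mathrm{Act}$. (If $G$ is not a state of $\mathcal{M}^{\mathrm{opt}}_n$, $\mathbf{F}G$ is empty there.) $\mathcal{M}$ is non-fleeing w.r.t. $G$ (from $s_0$) if for every pure positional scheduler $\sigma$ of $\mathcal{M}^{\sup}$, $\mathbb{P}^\sigma_{\mathcal{M}^{\sup},s_0}\big(\mathsf{div}\cap\mathbf{F}\,\mathrm{Avoid}^\sigma_{\mathcal{M}^{\sup}}(G)\big)=0$, where $\mathsf{div}=\bigcap_{n\in\mathbb{N}}\mathbf{F}\big(R_{n+1}^{\sup}\setminus R_n^{\sup}\big)$. *)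

theory Defs
  imports "HOL-Probability.Probability"
begin

section \<open>Markov decision processes\<close>

record ('s, 'a) mdp =
  states :: "'s set"
  acts :: "'a set"
  tr :: "'s \<Rightarrow> 'a \<Rightarrow> 's \<Rightarrow> real"

definition enabled :: "('s, 'a) mdp \<Rightarrow> 's \<Rightarrow> 'a set" where
  "enabled M s = {a \<in> acts M. (tr M s a has_sum 1) (states M)}"

text \<open>Only the values of \<^const>\<open>tr\<close> on the two carriers are meaningful.\<close>

definition valid_mdp :: "('s, 'a) mdp \<Rightarrow> bool" where
  "valid_mdp M \<longleftrightarrow>
     countable (states M) \<and> countable (acts M) \<and>
     (\<forall>s\<in>states M. \<forall>a\<in>acts M. \<forall>s'\<in>states M. tr M s a s' \<in> {0..1} \<inter> \<rat>) \<and>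
     (\<forall>s\<in>states M. \<forall>a\<in>acts M.
        (tr M s a has_sum 0) (states M) \<or> (tr M s a has_sum 1) (states M)) \<and>
     (\<forall>s\<in>states M. enabled M s \<noteq> {})"

definition finitely_branching :: "('s, 'a) mdp \<Rightarrow> bool" where
  "finitely_branching M \<longleftrightarrow>
     (\<forall>s\<in>states M. finite (enabled M s)) \<and>
     (\<forall>s\<in>states M. \<forall>a\<in>acts M. finite {s' \<in> states M. tr M s a s' \<noteq> 0})"

definition absorbing :: "('s, 'a) mdp \<Rightarrow> 's \<Rightarrow> bool" where
  "absorbing M s \<longleftrightarrow> (\<forall>a\<in>enabled M s. tr M s a s = 1)"

section \<open>Schedulers and the induced path measure\<close>

text \<open>A history is a nonempty list of states, oldest state first.\<close>

definition Sched :: "('s, 'a) mdp \<Rightarrow> ('s list \<Rightarrow> 'a pmf) set" where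
  "Sched M = {\<sigma>. \<forall>h. h \<noteq> [] \<and> set h \<subseteq> states M \<longrightarrow> set_pmf (\<sigma> h) \<subseteq> enabled M (last h)}"

definition Positional :: "('s, 'a) mdp \<Rightarrow> ('s \<Rightarrow> 'a) set" where
  "Positional M = {\<sigma>. \<forall>s\<in>states M. \<sigma> s \<in> enabled M s}"

definition sched_of :: "('s \<Rightarrow> 'a) \<Rightarrow> 's list \<Rightarrow> 'a pmf" where
  "sched_of \<sigma> h = return_pmf (\<sigma> (last h))"

definition step :: "('s, 'a) mdp \<Rightarrow> ('s list \<Rightarrow> 'a pmf) \<Rightarrow> 's list \<Rightarrow> 's \<Rightarrow> real" where
  "step M \<sigma> h s' = measure_pmf.expectation (\<sigma> h) (\<lambda>a. tr M (last h) a s')"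

text \<open>The distribution of the state at time \<open>n\<close> given the states at times \<open>0, \<dots>, n - 1\<close>.\<close>

definition path_kernel ::
  "('s, 'a) mdp \<Rightarrow> ('s list \<Rightarrow> 'a pmf) \<Rightarrow> 's \<Rightarrow> nat \<Rightarrow> (nat \<Rightarrow> 's) \<Rightarrow> 's measure" where
  "path_kernel M \<sigma> s n \<omega> = density (count_space (states M))
     (\<lambda>s'. if n = 0 then indicator {s} s' else ennreal (step M \<sigma> (map \<omega> [0..<n]) s'))"

text \<open>
  The measure on infinite paths that the Ionescu-Tulcea theorem assigns to these kernels. The
  theorem \<open>emeasure_path_cylinder\<close> below gives its values on cylinder sets.
\<close>

definition path_measure ::
  "('s, 'a) mdp \<Rightarrow> ('s list \<Rightarrow> 'a pmf) \<Rightarrow> 's \<Rightarrow> (nat \<Rightarrow> 's) measure" where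
  "path_measure M \<sigma> s =
     projective_family.lim UNIV
       (Ionescu_Tulcea.CI (path_kernel M \<sigma> s) (\<lambda>_. count_space (states M)))
       (\<lambda>_. count_space (states M))"

definition path_prob ::
  "('s, 'a) mdp \<Rightarrow> ('s list \<Rightarrow> 'a pmf) \<Rightarrow> 's \<Rightarrow> ((nat \<Rightarrow> 's) \<Rightarrow> bool) \<Rightarrow> real" where
  "path_prob M \<sigma> s \<phi> = \<P>(\<omega> in path_measure M \<sigma> s. \<phi> \<omega>)"

definition reaches :: "'s set \<Rightarrow> (nat \<Rightarrow> 's) \<Rightarrow> bool" where
  "reaches A \<omega> \<longleftrightarrow> (\<exists>i. \<omega> i \<in> A)"

datatype optimum = OptInf | OptSup

fun opt_prob :: "optimum \<Rightarrow> ('s, 'a) mdp \<Rightarrow> 's \<Rightarrow> ((nat \<Rightarrow> 's) \<Rightarrow> bool) \<Rightarrow> real" where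
  "opt_prob OptInf M s \<phi> = (INF \<sigma>\<in>Sched M. path_prob M \<sigma> s \<phi>)"
| "opt_prob OptSup M s \<phi> = (SUP \<sigma>\<in>Sched M. path_prob M \<sigma> s \<phi>)"

section \<open>Avoid sets and univ-decisiveness\<close>

definition Avoid_opt :: "optimum \<Rightarrow> ('s, 'a) mdp \<Rightarrow> 's \<Rightarrow> 's set" where
  "Avoid_opt opt M G = {s \<in> states M. opt_prob opt M s (reaches {G}) = 0}"

definition Avoid_sched :: "('s \<Rightarrow> 'a) \<Rightarrow> ('s, 'a) mdp \<Rightarrow> 's \<Rightarrow> 's set" where
  "Avoid_sched \<sigma> M G = {s \<in> states M. path_prob M (sched_of \<sigma>) s (reaches {G}) = 0}"

definition univ_decisive :: "('s, 'a) mdp \<Rightarrow> 's \<Rightarrow> 's \<Rightarrow> bool" where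
  "univ_decisive M G s \<longleftrightarrow>
     (\<forall>\<sigma>\<in>Positional M.
        path_prob M (sched_of \<sigma>) s (\<lambda>\<omega>. reaches {G} \<omega> \<or> reaches (Avoid_sched \<sigma> M G) \<omega>) = 1)"

section \<open>Collapsed and sliced MDPs\<close>

text \<open>In both constructions \<^const>\<open>None\<close> is the fresh sink state.\<close>

fun collapse_tr ::
  "optimum \<Rightarrow> ('s, 'a) mdp \<Rightarrow> 's \<Rightarrow> 's option \<Rightarrow> 'a \<Rightarrow> 's option \<Rightarrow> real" where
  "collapse_tr opt M G (Some s) a (Some s') = tr M s a s'"
| "collapse_tr opt M G (Some s) a None = (\<Sum>\<^sub>\<infinity>s'\<in>Avoid_opt opt M G. tr M s a s')"
| "collapse_tr opt M G None a s' = (if s' = None then 1 else 0)"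

definition collapse :: "optimum \<Rightarrow> ('s, 'a) mdp \<Rightarrow> 's \<Rightarrow> ('s option, 'a) mdp" where
  "collapse opt M G =
     \<lparr>states = insert None (Some ` (states M - Avoid_opt opt M G)),
      acts = acts M,
      tr = collapse_tr opt M G\<rparr>"

primrec reach_within :: "('s, 'a) mdp \<Rightarrow> 's \<Rightarrow> nat \<Rightarrow> 's set" where
  "reach_within M s0 0 = {s0}"
| "reach_within M s0 (Suc n) = reach_within M s0 n \<union>
     {s' \<in> states M. \<exists>s\<in>reach_within M s0 n. \<exists>a\<in>acts M. tr M s a s' > 0}"

fun slice_tr ::
  "('s, 'a) mdp \<Rightarrow> 's \<Rightarrow> nat \<Rightarrow> 's option \<Rightarrow> 'a \<Rightarrow> 's option \<Rightarrow> real" where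
  "slice_tr M s0 n (Some s) a (Some s') = tr M s a s'"
| "slice_tr M s0 n (Some s) a None = (\<Sum>\<^sub>\<infinity>s'\<in>states M - reach_within M s0 n. tr M s a s')"
| "slice_tr M s0 n None a s' = (if s' = None then 1 else 0)"

definition slice :: "('s, 'a) mdp \<Rightarrow> 's \<Rightarrow> nat \<Rightarrow> ('s option, 'a) mdp" where
  "slice M s0 n =
     \<lparr>states = insert None (Some ` reach_within M s0 n),
      acts = acts M,
      tr = slice_tr M s0 n\<rparr>"

definition diverges :: "('s, 'a) mdp \<Rightarrow> 's \<Rightarrow> (nat \<Rightarrow> 's) \<Rightarrow> bool" where
  "diverges M s0 \<omega> \<longleftrightarrow>
     (\<forall>n. reaches (reach_within M s0 (Suc n) - reach_within M s0 n) \<omega>)"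

definition non_fleeing :: "('s, 'a) mdp \<Rightarrow> 's \<Rightarrow> 's \<Rightarrow> bool" where
  "non_fleeing M G s0 \<longleftrightarrow>
     (let N = collapse OptSup M G in
      \<forall>\<sigma>\<in>Positional N.
        path_prob N (sched_of \<sigma>) (Some s0)
          (\<lambda>\<omega>. diverges N (Some s0) \<omega> \<and> reaches (Avoid_sched \<sigma> N (Some G)) \<omega>) = 0)"

text \<open>
  A state \<open>s\<close> of \<open>M\<close> that survives the collapse and the slicing is \<open>Some (Some s)\<close> in the sliced
  MDP, the sink of the collapse is \<open>Some None\<close>, and the sink of the slicing is \<open>None\<close>.
\<close>

definition approx_mdp ::
  "optimum \<Rightarrow> ('s, 'a) mdp \<Rightarrow> 's \<Rightarrow> 's \<Rightarrow> nat \<Rightarrow> ('s option option, 'a) mdp" where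
  "approx_mdp opt M G s0 n = slice (collapse opt M G) (Some s0) n"

definition q_minus :: "optimum \<Rightarrow> ('s, 'a) mdp \<Rightarrow> 's \<Rightarrow> 's \<Rightarrow> nat \<Rightarrow> real" where
  "q_minus opt M G s0 n =
     opt_prob opt (approx_mdp opt M G s0 n) (Some (Some s0)) (reaches {Some (Some G)})"

definition q_plus :: "optimum \<Rightarrow> ('s, 'a) mdp \<Rightarrow> 's \<Rightarrow> 's \<Rightarrow> nat \<Rightarrow> real" where
  "q_plus opt M G s0 n =
     opt_prob opt (approx_mdp opt M G s0 n) (Some (Some s0)) (reaches {Some (Some G), None})"

section \<open>Well-definedness of the path measure and of the constructions\<close>

lemma step_kernel:
  assumes M: "valid_mdp M" and \<sigma>: "\<sigma> \<in> Sched M" and h: "h \<noteq> []" "set h \<subseteq> states M"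
  shows "(\<integral>\<^sup>+ s'. ennreal (step M \<sigma> h s') \<partial>count_space (states M)) = 1"
proof -
  have l: "last h \<in> states M" using h by auto
  have sup: "set_pmf (\<sigma> h) \<subseteq> enabled M (last h)" using \<sigma> h by (auto simp: Sched_def)
  have bnd: "0 \<le> tr M (last h) a s' \<and> tr M (last h) a s' \<le> 1"
    if "a \<in> set_pmf (\<sigma> h)" "s' \<in> states M" for a s'
  proof -
    have "a \<in> acts M" using sup that by (auto simp: enabled_def)
    then have "tr M (last h) a s' \<in> {0..1} \<inter> \<rat>"
      using M l that unfolding valid_mdp_def by blast
    then show ?thesis by simp
  qed
  have eq: "ennreal (step M \<sigma> h s') = (\<integral>\<^sup>+ a. ennreal (tr M (last h) a s') \<partial>measure_pmf (\<sigma> h))"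
    if "s' \<in> states M" for s'
    unfolding step_def
  proof (rule nn_integral_eq_integral[symmetric])
    show "integrable (measure_pmf (\<sigma> h)) (\<lambda>a. tr M (last h) a s')"
      by (rule measure_pmf.integrable_const_bound[where B = 1])
        (use bnd that in \<open>auto simp: AE_measure_pmf_iff\<close>)
    show "AE a in measure_pmf (\<sigma> h). 0 \<le> tr M (last h) a s'"
      using bnd that by (auto simp: AE_measure_pmf_iff)
  qed
  have cS: "countable (states M)" using M by (simp add: valid_mdp_def)
  have "(\<integral>\<^sup>+ s'. ennreal (step M \<sigma> h s') \<partial>count_space (states M))
      = (\<integral>\<^sup>+ s'. (\<integral>\<^sup>+ a. ennreal (tr M (last h) a s') \<partial>measure_pmf (\<sigma> h)) \<partial>count_space (states M))"
    by (rule nn_integral_cong) (simp add: eq)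
  also have "\<dots> = (\<integral>\<^sup>+ a. (\<integral>\<^sup>+ s'. ennreal (tr M (last h) a s') \<partial>count_space (states M))
      \<partial>measure_pmf (\<sigma> h))"
    by (rule nn_integral_count_space_nn_integral[OF cS, symmetric]) simp
  also have "\<dots> = (\<integral>\<^sup>+ a. 1 \<partial>measure_pmf (\<sigma> h))"
  proof (intro nn_integral_cong_AE, subst AE_measure_pmf_iff, intro ballI)
    fix a assume a: "a \<in> set_pmf (\<sigma> h)"
    have hs: "(tr M (last h) a has_sum 1) (states M)" using sup a by (auto simp: enabled_def)
    have nn: "norm (tr M (last h) a s') = tr M (last h) a s'" if "s' \<in> states M" for s'
      using bnd[OF a that] by simp
    have "Infinite_Sum.abs_summable_on (tr M (last h) a) (states M)"
      using has_sum_imp_summable[OF hs] by (subst summable_on_cong[OF nn])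
    then have abs: "Infinite_Set_Sum.abs_summable_on (tr M (last h) a) (states M)"
      by (simp only: abs_summable_equivalent)
    have "ennreal (infsetsum (tr M (last h) a) (states M))
        = (\<integral>\<^sup>+ s'. ennreal (tr M (last h) a s') \<partial>count_space (states M))"
      by (rule nn_integral_conv_infsetsum[symmetric, OF abs]) (use bnd a in auto)
    then show "(\<integral>\<^sup>+ s'. ennreal (tr M (last h) a s') \<partial>count_space (states M)) = 1"
      using infsumI[OF hs] infsetsum_infsum[OF abs] by simp
  qed
  finally show ?thesis by simp
qed

lemma emeasure_path_kernel:
  assumes "x \<in> states M"
  shows "emeasure (path_kernel M \<sigma> s n \<omega>) {x} =
    (if n = 0 then indicator {s} x else ennreal (step M \<sigma> (map \<omega> [0..<n]) x))"
  using assms unfolding path_kernel_def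
  by (subst emeasure_density) (simp_all add: nn_integral_indicator_singleton)

lemma Ionescu_Tulcea_path_kernel:
  assumes M: "valid_mdp M" and \<sigma>: "\<sigma> \<in> Sched M" and s: "s \<in> states M"
  shows "Ionescu_Tulcea (path_kernel M \<sigma> s) (\<lambda>_. count_space (states M))"
proof -
  have cS: "countable (states M)" using M by (simp add: valid_mdp_def)
  have P: "prob_space (path_kernel M \<sigma> s i x)"
    if "x \<in> space (PiM {0..<i} (\<lambda>_. count_space (states M)))" for i x
  proof (rule prob_spaceI)
    have "set (map x [0..<i]) \<subseteq> states M" using that by (auto simp: space_PiM PiE_iff)
    moreover have "(\<integral>\<^sup>+ s'. indicator {s} s' \<partial>count_space (states M)) = 1"
      using s by (subst nn_integral_indicator) auto
    ultimately have "(\<integral>\<^sup>+ s'. (if i = 0 then indicator {s} s'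
        else ennreal (step M \<sigma> (map x [0..<i]) s')) \<partial>count_space (states M)) = 1"
      using step_kernel[OF M \<sigma>, of "map x [0..<i]"] by (cases "i = 0") auto
    then show "emeasure (path_kernel M \<sigma> s i x) (space (path_kernel M \<sigma> s i x)) = 1"
      unfolding path_kernel_def
      by (subst emeasure_density) (auto cong: nn_integral_cong_simp)
  qed
  show ?thesis
  proof (rule Ionescu_Tulcea.intro)
    fix i :: nat
    have "PiM {0..<i} (\<lambda>_. count_space (states M)) = count_space (PiE {0..<i} (\<lambda>_. states M))"
      using cS by (intro count_space_PiM_finite) auto
    moreover have "path_kernel M \<sigma> s i x \<in> space (subprob_algebra (count_space (states M)))"
      if "x \<in> PiE {0..<i} (\<lambda>_. states M)" for x
      using P[of x i] that
      by (auto simp: space_subprob_algebra space_PiM path_kernel_def prob_space_imp_subprob_space)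
    ultimately show "path_kernel M \<sigma> s i \<in> PiM {0..<i} (\<lambda>_. count_space (states M)) \<rightarrow>\<^sub>M
        subprob_algebra (count_space (states M))"
      by auto
  next
    fix i :: nat and x
    assume "x \<in> space (PiM {0..<i} (\<lambda>_. count_space (states M)))"
    then show "prob_space (path_kernel M \<sigma> s i x)" by (rule P)
  qed
qed

theorem
  assumes M: "valid_mdp M" and \<sigma>: "\<sigma> \<in> Sched M" and s: "s \<in> states M"
  shows prob_space_path_measure: "prob_space (path_measure M \<sigma> s)"
    and sets_path_measure: "sets (path_measure M \<sigma> s) = sets (PiM UNIV (\<lambda>_. count_space (states M)))"
    and space_path_measure: "space (path_measure M \<sigma> s) = UNIV \<rightarrow> states M"
    and emeasure_path_cylinder: "(\<And>i. i \<le> n \<Longrightarrow> x i \<in> states M) \<Longrightarrow>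
      emeasure (path_measure M \<sigma> s) {\<omega> \<in> UNIV \<rightarrow> states M. \<forall>i\<le>n. \<omega> i = x i} =
      indicator {s} (x 0) * (\<Prod>i<n. ennreal (step M \<sigma> (map x [0..<Suc i]) (x (Suc i))))"
proof -
  let ?N = "\<lambda>_::nat. count_space (states M)"
  interpret IT: Ionescu_Tulcea "path_kernel M \<sigma> s" ?N
    by (rule Ionescu_Tulcea_path_kernel[OF M \<sigma> s])
  have cS: "countable (states M)" using M by (simp add: valid_mdp_def)
  have fin: "PiM {0..<k} ?N = count_space (PiE {0..<k} (\<lambda>_. states M))" for k
    using cS by (intro count_space_PiM_finite) auto
  have ne: "states M \<noteq> {}" using s by auto
  have lim: "path_measure M \<sigma> s = IT.PF.lim" by (simp add: path_measure_def)
  show se: "sets (path_measure M \<sigma> s) = sets (PiM UNIV ?N)" by (simp add: lim)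
  show sp: "space (path_measure M \<sigma> s) = UNIV \<rightarrow> states M"
    by (simp add: sets_eq_imp_space_eq[OF se] space_PiM PiE_def)
  have cyl: "emeasure (path_measure M \<sigma> s) (prod_emb UNIV ?N {0..<k} X)
      = emeasure (IT.C 0 k (\<lambda>_. undefined)) X" if X: "X \<in> sets (PiM {0..<k} ?N)" for k X
    unfolding lim using IT.lim[OF _ X] IT.emeasure_CI[of "{0..<k}" k X] X
    by (simp add: prod_emb_id[OF sets.sets_into_space[OF X, unfolded space_PiM]])
  have e0: "prod_emb UNIV ?N {0..<0} (space (PiM {0..<0} ?N)) = space (path_measure M \<sigma> s)"
    unfolding sp by (auto simp: prod_emb_def space_PiM)
  show "prob_space (path_measure M \<sigma> s)"
    by (rule prob_spaceI, subst e0[symmetric], subst cyl)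
      (simp_all add: PiM_empty)
  have pt: "emeasure (IT.C 0 k (\<lambda>_. undefined)) {y}
      = (\<Prod>i<k. emeasure (path_kernel M \<sigma> s i (restrict y {0..<i})) {y i})"
    if "y \<in> PiE {0..<k} (\<lambda>_. states M)" for k y
    using that
  proof (induction k arbitrary: y)
    case 0
    then show ?case by (simp add: PiM_empty)
  next
    case (Suc k)
    let ?y = "restrict y {0..<k}"
    have y': "?y \<in> PiE {0..<k} (\<lambda>_. states M)" and yk: "y k \<in> states M"
      using Suc.prems by (auto simp: PiE_iff)
    have yS: "{y} \<in> sets (PiM {0..<Suc k} ?N)" using Suc.prems by (simp add: fin)
    have y'S: "{?y} \<in> sets (PiM {0..<k} ?N)" using y' by (simp add: fin)
    have upd: "fun_upd \<omega> k -` {y} \<inter> states M = (if \<omega> = ?y then {y k} else {})"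
      if "\<omega> \<in> PiE {0..<k} (\<lambda>_. states M)" for \<omega>
    proof -
      have "(fun_upd \<omega> k z = y) \<longleftrightarrow> (\<omega> = ?y \<and> z = y k)" for z
        using that Suc.prems
        by (fastforce simp: fun_eq_iff PiE_iff extensional_def less_Suc_eq restrict_def)
      then show ?thesis using yk by auto
    qed
    have "emeasure (IT.C 0 (Suc k) (\<lambda>_. undefined)) {y}
        = (\<integral>\<^sup>+ \<omega>. emeasure (IT.eP k \<omega>) {y} \<partial>IT.C 0 k (\<lambda>_. undefined))"
      by (simp, subst emeasure_bind[OF _ _ yS]) (auto simp: IT.space_C space_PiM PiE_eq_empty_iff ne
          IT.prob_space_C[THEN prob_space.not_empty] measurable_cong_sets[OF IT.sets_C refl])
    also have "\<dots> = (\<integral>\<^sup>+ \<omega>. emeasure (path_kernel M \<sigma> s k ?y) {y k} * indicator {?y} \<omega>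
        \<partial>IT.C 0 k (\<lambda>_. undefined))"
    proof (rule nn_integral_cong)
      fix \<omega> assume "\<omega> \<in> space (IT.C 0 k (\<lambda>_. undefined))"
      then have w: "\<omega> \<in> space (PiM {0..<k} ?N)" by (simp add: IT.space_C space_PiM)
      then have w': "\<omega> \<in> PiE {0..<k} (\<lambda>_. states M)" by (simp add: space_PiM)
      show "emeasure (IT.eP k \<omega>) {y}
          = emeasure (path_kernel M \<sigma> s k ?y) {y k} * indicator {?y} \<omega>"
        using IT.emeasure_eP[OF w yS] upd[OF w'] by (auto split: split_indicator)
    qed
    also have "\<dots> = emeasure (path_kernel M \<sigma> s k ?y) {y k}
        * emeasure (IT.C 0 k (\<lambda>_. undefined)) {?y}"
      by (rule nn_integral_cmult_indicator)
        (use y'S in \<open>simp add: IT.sets_C space_PiM\<close>)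
    also have "emeasure (IT.C 0 k (\<lambda>_. undefined)) {?y}
        = (\<Prod>i<k. emeasure (path_kernel M \<sigma> s i (restrict y {0..<i})) {y i})"
      by (subst Suc.IH[OF y']) (auto intro!: prod.cong simp: Int_absorb1)
    finally show ?case by (simp only: prod.lessThan_Suc mult.commute)
  qed
  show "emeasure (path_measure M \<sigma> s) {\<omega> \<in> UNIV \<rightarrow> states M. \<forall>i\<le>n. \<omega> i = x i} =
      indicator {s} (x 0) * (\<Prod>i<n. ennreal (step M \<sigma> (map x [0..<Suc i]) (x (Suc i))))"
    if x: "\<And>i. i \<le> n \<Longrightarrow> x i \<in> states M"
  proof -
    let ?x = "restrict x {0..<Suc n}"
    have xP: "?x \<in> PiE {0..<Suc n} (\<lambda>_. states M)" using x by auto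
    have "{\<omega> \<in> UNIV \<rightarrow> states M. \<forall>i\<le>n. \<omega> i = x i} = prod_emb UNIV ?N {0..<Suc n} {?x}"
    proof -
      have "(\<forall>i\<le>n. \<omega> i = x i) \<longleftrightarrow> restrict \<omega> {0..<Suc n} = ?x" for \<omega>
        by (metis atLeastLessThan_iff le0 less_Suc_eq_le restrict_apply' restrict_ext)
      then show ?thesis by (auto simp: prod_emb_def space_PiM PiE_def simp del: restrict_apply)
    qed
    moreover have "{?x} \<in> sets (PiM {0..<Suc n} ?N)" using xP by (simp add: fin)
    ultimately have "emeasure (path_measure M \<sigma> s) {\<omega> \<in> UNIV \<rightarrow> states M. \<forall>i\<le>n. \<omega> i = x i}
        = (\<Prod>i<Suc n. emeasure (path_kernel M \<sigma> s i (restrict ?x {0..<i})) {?x i})"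
      using cyl pt[OF xP] by simp
    also have "\<dots> = (\<Prod>i<Suc n. if i = 0 then indicator {s} (x 0)
        else ennreal (step M \<sigma> (map x [0..<i]) (x i)))"
    proof (rule prod.cong[OF refl])
      fix i assume i: "i \<in> {..<Suc n}"
      have "map (restrict ?x {0..<i}) [0..<i] = map x [0..<i]" using i by auto
      moreover have "?x i = x i" "x i \<in> states M" using i x by auto
      ultimately show "emeasure (path_kernel M \<sigma> s i (restrict ?x {0..<i})) {?x i} =
          (if i = 0 then indicator {s} (x 0) else ennreal (step M \<sigma> (map x [0..<i]) (x i)))"
        by (simp only: emeasure_path_kernel) simp
    qed
    also have "\<dots> = indicator {s} (x 0)
        * (\<Prod>i<n. ennreal (step M \<sigma> (map x [0..<Suc i]) (x (Suc i))))"
      by (subst prod.lessThan_Suc_shift) simp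
    finally show ?thesis .
  qed
qed

definition finite_support :: "('s, 'a) mdp \<Rightarrow> bool" where
  "finite_support M \<longleftrightarrow>
     (\<forall>s\<in>states M. \<forall>a\<in>acts M. finite {s' \<in> states M. tr M s a s' \<noteq> 0})"

text \<open>Merging a set \<open>D\<close> of states of an MDP with finitely supported transitions into a fresh sink.\<close>

lemma valid_mdp_sink:
  fixes M :: "('s, 'a) mdp" and N :: "('s option, 'a) mdp"
  assumes M: "valid_mdp M" and fb: "finite_support M" and ne: "acts M \<noteq> {}"
    and S: "states N = insert None (Some ` (states M - D))" and D: "D \<subseteq> states M"
    and A: "acts N = acts M"
    and t1: "\<And>s a s'. tr N (Some s) a (Some s') = tr M s a s'"
    and t2: "\<And>s a. tr N (Some s) a None = (\<Sum>\<^sub>\<infinity>s'\<in>D. tr M s a s')"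
    and t3: "\<And>a s'. tr N None a s' = (if s' = None then 1 else 0)"
  shows "valid_mdp N"
    and "finite_support N"
    and "u \<in> states M - D \<Longrightarrow> enabled N (Some u) = enabled M u"
    and "enabled N None = acts M"
proof -
  have sum_in: "sum f A \<in> \<rat>" if "\<And>x. x \<in> A \<Longrightarrow> f x \<in> \<rat>" for f :: "'s \<Rightarrow> real" and A
    using that by (induction A rule: infinite_finite_induct) auto
  have hs: "(tr N (Some s) a has_sum x) (states N) \<longleftrightarrow> (tr M s a has_sum x) (states M)"
    and nn: "tr N (Some s) a None \<in> {0..1} \<inter> \<rat>"
    if s: "s \<in> states M - D" and a: "a \<in> acts M" for s a x
  proof -
    let ?F = "{s' \<in> states M. tr M s a s' \<noteq> 0}"
    have F: "finite ?F" using fb s a by (auto simp: finite_support_def)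
    have rg: "tr M s a s' \<in> {0..1} \<inter> \<rat>" if "s' \<in> states M" for s'
      using M s a that unfolding valid_mdp_def by blast
    have inf: "(\<Sum>\<^sub>\<infinity>s'\<in>D. tr M s a s') = (\<Sum>s'\<in>D \<inter> ?F. tr M s a s')"
      by (subst infsum_cong_neutral[where T = "D \<inter> ?F" and g = "tr M s a"]) (use D F in auto)
    have hM: "(tr M s a has_sum x) (states M) \<longleftrightarrow> (\<Sum>s'\<in>?F. tr M s a s') = x" for x
    proof -
      have "(tr M s a has_sum x) (states M) \<longleftrightarrow> (tr M s a has_sum x) ?F"
        by (rule has_sum_cong_neutral) auto
      then show ?thesis using F by (auto simp: has_sum_finite_iff)
    qed
    let ?E = "insert None (Some ` (?F - D))"
    have "(tr N (Some s) a has_sum x) (states N) \<longleftrightarrow> (tr N (Some s) a has_sum x) ?E"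
      by (rule has_sum_cong_neutral) (auto simp: S t1)
    also have "\<dots> \<longleftrightarrow> (\<Sum>s'\<in>?E. tr N (Some s) a s') = x"
      using F by (auto simp: has_sum_finite_iff)
    also have "(\<Sum>s'\<in>?E. tr N (Some s) a s') = (\<Sum>s'\<in>?F. tr M s a s')"
    proof -
      have "(\<Sum>s'\<in>?E. tr N (Some s) a s')
          = (\<Sum>s'\<in>D \<inter> ?F. tr M s a s') + (\<Sum>s'\<in>?F - D. tr M s a s')"
        using F by (subst sum.insert) (auto simp: t1 t2 inf sum.reindex)
      also have "\<dots> = (\<Sum>s'\<in>(D \<inter> ?F) \<union> (?F - D). tr M s a s')"
        using F by (intro sum.union_disjoint[symmetric]) auto
      also have "(D \<inter> ?F) \<union> (?F - D) = ?F" by auto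
      finally show ?thesis .
    qed
    finally show "(tr N (Some s) a has_sum x) (states N) \<longleftrightarrow> (tr M s a has_sum x) (states M)"
      by (simp add: hM)
    have "(tr M s a has_sum 0) (states M) \<or> (tr M s a has_sum 1) (states M)"
      using M s a by (simp add: valid_mdp_def)
    then have "(\<Sum>s'\<in>?F. tr M s a s') \<le> 1" by (auto simp: hM)
    moreover have "(\<Sum>s'\<in>D \<inter> ?F. tr M s a s') \<le> (\<Sum>s'\<in>?F. tr M s a s')"
      using F rg by (intro sum_mono2) auto
    moreover have "0 \<le> (\<Sum>s'\<in>D \<inter> ?F. tr M s a s')" using rg by (intro sum_nonneg) auto
    moreover have "(\<Sum>s'\<in>D \<inter> ?F. tr M s a s') \<in> \<rat>"
      by (rule sum_in) (use rg in auto)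
    ultimately show "tr N (Some s) a None \<in> {0..1} \<inter> \<rat>" by (simp add: t2 inf)
  qed
  have hN: "(tr N None a has_sum 1) (states N)" for a
  proof -
    have "(tr N None a has_sum 1) (states N) \<longleftrightarrow> (tr N None a has_sum 1) {None}"
      by (rule has_sum_cong_neutral) (auto simp: S t3)
    then show ?thesis by (simp add: has_sum_finite_iff t3)
  qed
  show en: "s \<in> states M - D \<Longrightarrow> enabled N (Some s) = enabled M s" for s
    using hs[of s] by (auto simp: enabled_def A)
  show en0: "enabled N None = acts M" using hN by (auto simp: enabled_def A)
  have r: "tr M s a s' \<in> {0..1} \<inter> \<rat>"
    if "s \<in> states M" "a \<in> acts M" "s' \<in> states M" for s a s'
    using M that by (simp add: valid_mdp_def)
  have "tr N s a s' \<in> {0..1} \<inter> \<rat>" if "s \<in> states N" "a \<in> acts N" "s' \<in> states N" for s a s'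
  proof (cases s)
    case None
    then show ?thesis by (simp add: t3)
  next
    case (Some v)
    then have v: "v \<in> states M - D" "a \<in> acts M" using that by (auto simp: S A)
    show ?thesis
    proof (cases s')
      case None
      then show ?thesis using nn[OF v] Some by simp
    next
      case (Some v')
      then have "v' \<in> states M" using that by (auto simp: S)
      then show ?thesis using r[of v a v'] v \<open>s = Some v\<close> Some by (simp add: t1)
    qed
  qed
  moreover have "(tr N s a has_sum 0) (states N) \<or> (tr N s a has_sum 1) (states N)"
    if "s \<in> states N" "a \<in> acts N" for s a
  proof (cases s)
    case None
    then show ?thesis using hN by simp
  next
    case (Some v)
    then have v: "v \<in> states M - D" "a \<in> acts M" using that by (auto simp: S A)
    then have "(tr M v a has_sum 0) (states M) \<or> (tr M v a has_sum 1) (states M)"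
      using M by (simp add: valid_mdp_def)
    then show ?thesis unfolding Some by (simp only: hs[OF v])
  qed
  moreover have "enabled N s \<noteq> {}" if "s \<in> states N" for s
  proof (cases s)
    case None
    then show ?thesis using ne en0 by simp
  next
    case (Some v)
    then have "v \<in> states M - D" using that by (auto simp: S)
    then show ?thesis using M by (simp add: Some en valid_mdp_def)
  qed
  moreover have "countable (states N)" "countable (acts N)"
    using M by (auto simp: valid_mdp_def S A)
  ultimately show "valid_mdp N" unfolding valid_mdp_def by blast
  have "finite {s' \<in> states N. tr N s a s' \<noteq> 0}" if s: "s \<in> states N" "a \<in> acts N" for s a
  proof (cases s)
    case None
    have "{s' \<in> states N. tr N s a s' \<noteq> 0} \<subseteq> {None}" by (auto simp: None t3)
    then show ?thesis using finite_subset by blast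
  next
    case (Some u)
    have "{s' \<in> states N. tr N s a s' \<noteq> 0}
        \<subseteq> insert None (Some ` {s' \<in> states M. tr M u a s' \<noteq> 0})"
      by (auto simp: Some t1 S)
    moreover have "finite {s' \<in> states M. tr M u a s' \<noteq> 0}"
      using fb s by (auto simp: finite_support_def Some S A)
    ultimately show ?thesis using finite_subset by blast
  qed
  then show "finite_support N" by (simp add: finite_support_def)
qed

lemma
  assumes M: "valid_mdp M" "finitely_branching M" "acts M \<noteq> {}"
  shows valid_mdp_collapse: "valid_mdp (collapse opt M G)"
    and finite_support_collapse: "finite_support (collapse opt M G)"
proof -
  have "finite_support M" using M(2) by (simp add: finitely_branching_def finite_support_def)
  note * = valid_mdp_sink[OF M(1) this M(3), where D = "Avoid_opt opt M G"]
  show "valid_mdp (collapse opt M G)"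
    by (rule *(1)) (auto simp: collapse_def Avoid_opt_def)
  show "finite_support (collapse opt M G)"
    by (rule *(2)) (auto simp: collapse_def Avoid_opt_def)
qed

lemma valid_mdp_slice:
  assumes "valid_mdp M" "finite_support M" "acts M \<noteq> {}" and s0: "s0 \<in> states M"
  shows "valid_mdp (slice M s0 n)"
proof -
  have "reach_within M s0 n \<subseteq> states M" using s0 by (induction n) auto
  then have "states M - (states M - reach_within M s0 n) = reach_within M s0 n" by blast
  then have eq: "states (slice M s0 n)
      = insert None (Some ` (states M - (states M - reach_within M s0 n)))"
    by (simp only: slice_def mdp.select_convs)
  show ?thesis
    by (rule valid_mdp_sink(1)[OF assms(1-3) eq Diff_subset]) (simp_all add: slice_def)
qed

lemma valid_mdp_approx_mdp:
  assumes M: "valid_mdp M" "finitely_branching M" and s0: "s0 \<in> states M - Avoid_opt opt M G"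
  shows "valid_mdp (approx_mdp opt M G s0 n)"
proof -
  have "enabled M s0 \<noteq> {}" using M s0 by (auto simp: valid_mdp_def)
  then have ne: "acts M \<noteq> {}" by (auto simp: enabled_def)
  show ?thesis
    unfolding approx_mdp_def
    by (rule valid_mdp_slice[OF valid_mdp_collapse[OF M ne] finite_support_collapse[OF M ne]])
      (use s0 ne in \<open>auto simp: collapse_def\<close>)
qed

end

theory Submission
  imports Defs
begin

text \<open>
  Let \<open>N\<close> be the collapsed MDP, \<open>R n\<close> its states reachable within \<open>n\<close> steps and \<open>E n \<sigma>\<close> the
  probability in \<open>N\<close> of reaching \<open>G\<close> or leaving \<open>R n\<close> under \<open>\<sigma>\<close>. A path that leaves every \<open>R n\<close>
  diverges, so for fixed positional \<open>\<sigma>\<close> decisiveness and non-fleeing give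
  \<open>E n \<sigma> \<longlonglongrightarrow> P\<^sup>\<sigma>(F G)\<close>.

  For the supremum, choose positional \<open>\<sigma> n\<close> with \<open>q\<^sup>+ n \<le> E n (\<sigma> n) + \<epsilon>\<close>. By finite branching some
  positional \<open>\<rho>\<close> agrees on each finite set of states with infinitely many \<open>\<sigma> n\<close>. As \<open>E m\<close> depends
  only on the choices in the finite set \<open>R m\<close>, this yields \<open>q\<^sup>+ n \<le> E m \<rho> + \<epsilon>\<close> for suitable large
  \<open>n\<close>, while \<open>q\<^sup>- n\<close> is at least the probability under \<open>\<rho>\<close> of reaching \<open>G\<close> within \<open>n\<close> steps.

  For the infimum, some positional \<open>\<sigma>\<close> is optimal on the whole of \<open>M\<close> and hence avoids \<open>G\<close> exactly
  from the collapsed states. So almost every path under \<open>\<sigma>\<close> reaches \<open>G\<close> or the sink of \<open>N\<close> and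
  non-fleeing is automatic: \<open>q\<^sup>+ n \<le> E n \<sigma>\<close> tends to the value of \<open>M\<close>, and \<open>q\<^sup>- n\<close> dominates its
  \<open>n\<close>-step approximation.
\<close>

section \<open>Reachability probabilities by iteration\<close>

text \<open>Values in \<open>ennreal\<close> let sums, suprema and integrals be exchanged without
  integrability conditions. Negative entries count as 0, so monotonicity needs no validity of the
  row.\<close>

definition avg :: "('s, 'a) mdp \<Rightarrow> 's \<Rightarrow> 'a \<Rightarrow> ('s \<Rightarrow> ennreal) \<Rightarrow> ennreal" where
  "avg M s a f = (\<integral>\<^sup>+ s'. ennreal (tr M s a s') * f s' \<partial>count_space (states M))"

text \<open>This is the probability of hitting \<open>T\<close> within \<open>k\<close> further
  steps when the current state is \<open>last h\<close>. Earlier visits recorded in \<open>h\<close>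
  do not count; \<open>h\<close> only informs the scheduler.\<close>

primrec reach_val ::
  "('s, 'a) mdp \<Rightarrow> ('s list \<Rightarrow> 'a pmf) \<Rightarrow> 's set \<Rightarrow> nat \<Rightarrow> 's list \<Rightarrow> ennreal" where
  "reach_val M \<sigma> T 0 h = indicator T (last h)"
| "reach_val M \<sigma> T (Suc k) h = (if last h \<in> T then 1
     else \<integral>\<^sup>+ a. avg M (last h) a (\<lambda>s'. reach_val M \<sigma> T k (h @ [s'])) \<partial>measure_pmf (\<sigma> h))"

primrec pos_val :: "('s, 'a) mdp \<Rightarrow> ('s \<Rightarrow> 'a) \<Rightarrow> 's set \<Rightarrow> nat \<Rightarrow> 's \<Rightarrow> ennreal" where
  "pos_val M \<sigma> T 0 s = indicator T s"
| "pos_val M \<sigma> T (Suc k) s = (if s \<in> T then 1 else avg M s (\<sigma> s) (pos_val M \<sigma> T k))"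

lemma reach_val_sched_of: "reach_val M (sched_of \<sigma>) T k h = pos_val M \<sigma> T k (last h)"
  by (induction k arbitrary: h) (simp_all add: sched_of_def cong: if_cong)

lemma sched_of_in_Sched: "\<sigma> \<in> Positional M \<Longrightarrow> sched_of \<sigma> \<in> Sched M"
  by (auto simp: Positional_def Sched_def sched_of_def subset_iff)

lemma enabled_in_acts: "a \<in> enabled M s \<Longrightarrow> a \<in> acts M"
  by (simp add: enabled_def)

lemma tr_bounds:
  assumes "valid_mdp M" "s \<in> states M" "a \<in> acts M" "s' \<in> states M"
  shows "0 \<le> tr M s a s'" "tr M s a s' \<le> 1"
proof -
  have "tr M s a s' \<in> {0..1} \<inter> \<rat>" using assms unfolding valid_mdp_def by blast
  then show "0 \<le> tr M s a s'" "tr M s a s' \<le> 1" by auto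
qed

lemma avg_mono:
  assumes "\<And>s'. s' \<in> states M \<Longrightarrow> 0 < tr M s a s' \<Longrightarrow> f s' \<le> g s'"
  shows "avg M s a f \<le> avg M s a g"
  unfolding avg_def
proof (rule nn_integral_mono)
  fix s' assume "s' \<in> space (count_space (states M))"
  then show "ennreal (tr M s a s') * f s' \<le> ennreal (tr M s a s') * g s'"
    using assms[of s'] by (cases "0 < tr M s a s'") (auto intro!: mult_left_mono simp: ennreal_neg)
qed

lemma avg_cong:
  assumes "\<And>s'. s' \<in> states M \<Longrightarrow> 0 < tr M s a s' \<Longrightarrow> f s' = g s'"
  shows "avg M s a f = avg M s a g"
  using assms by (intro antisym avg_mono) auto

lemma avg_cong_row: "tr M s a = tr M s b \<Longrightarrow> avg M s a = avg M s b"
  by (simp add: avg_def fun_eq_iff)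

lemma avg_const:
  assumes M: "valid_mdp M" and s: "s \<in> states M" and a: "a \<in> enabled M s"
  shows "avg M s a (\<lambda>_. c) = c"
proof -
  have hs: "(tr M s a has_sum 1) (states M)" using a by (simp add: enabled_def)
  have nn: "norm (tr M s a s') = tr M s a s'" if "s' \<in> states M" for s'
    using tr_bounds[OF M s enabled_in_acts[OF a] that] by simp
  have "Infinite_Sum.abs_summable_on (tr M s a) (states M)"
    using has_sum_imp_summable[OF hs] by (subst summable_on_cong[OF nn])
  then have abs: "Infinite_Set_Sum.abs_summable_on (tr M s a) (states M)"
    by (simp only: abs_summable_equivalent)
  have "ennreal (infsetsum (tr M s a) (states M))
      = (\<integral>\<^sup>+ s'. ennreal (tr M s a s') \<partial>count_space (states M))"
    by (rule nn_integral_conv_infsetsum[symmetric, OF abs])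
      (use tr_bounds[OF M s enabled_in_acts[OF a]] in auto)
  then have "(\<integral>\<^sup>+ s'. ennreal (tr M s a s') \<partial>count_space (states M)) = 1"
    using infsumI[OF hs] infsetsum_infsum[OF abs] by simp
  then show ?thesis by (simp add: avg_def nn_integral_multc)
qed

lemma avg_add: "avg M s a (\<lambda>s'. f s' + g s') = avg M s a f + avg M s a g"
  by (simp add: avg_def distrib_left nn_integral_add)

lemma avg_cmult: "avg M s a (\<lambda>s'. c * f s') = c * avg M s a f"
  by (simp add: avg_def nn_integral_cmult[symmetric] mult.left_commute)

text \<open>Monotone convergence; it lets the limit of a value iteration pass through one
  step.\<close>

lemma avg_SUP:
  assumes "incseq f"
  shows "avg M s a (\<lambda>s'. SUP k. f k s') = (SUP k. avg M s a (f k))"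
proof -
  have "incseq (\<lambda>k s'. ennreal (tr M s a s') * f k s')"
    using assms by (simp add: incseq_def le_fun_def mult_left_mono)
  then have "(\<integral>\<^sup>+ s'. (SUP k. ennreal (tr M s a s') * f k s') \<partial>count_space (states M))
      = (SUP k. \<integral>\<^sup>+ s'. ennreal (tr M s a s') * f k s' \<partial>count_space (states M))"
    by (rule nn_integral_monotone_convergence_SUP) (rule borel_measurable_count_space)
  moreover have "ennreal (tr M s a s') * (SUP k. f k s') = (SUP k. ennreal (tr M s a s') * f k s')" for s'
    by (rule SUP_mult_left_ennreal)
  ultimately show ?thesis by (simp only: avg_def)
qed

text \<open>By Tonelli, the next-state distribution is a mixture over the actions, so an average
  over next states can be computed action by action.\<close>

lemma step_avg:
  assumes M: "valid_mdp M" and \<sigma>: "\<sigma> \<in> Sched M" and h: "h \<noteq> []" "set h \<subseteq> states M"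
  shows "(\<integral>\<^sup>+ s'. ennreal (step M \<sigma> h s') * f s' \<partial>count_space (states M))
    = (\<integral>\<^sup>+ a. avg M (last h) a f \<partial>measure_pmf (\<sigma> h))"
proof -
  have l: "last h \<in> states M" using h by auto
  have sup: "set_pmf (\<sigma> h) \<subseteq> enabled M (last h)" using \<sigma> h by (auto simp: Sched_def)
  have bnd: "0 \<le> tr M (last h) a s' \<and> tr M (last h) a s' \<le> 1"
    if "a \<in> set_pmf (\<sigma> h)" "s' \<in> states M" for a s'
    using tr_bounds[OF M l enabled_in_acts that(2)] sup that(1) by blast
  have eq: "ennreal (step M \<sigma> h s') = (\<integral>\<^sup>+ a. ennreal (tr M (last h) a s') \<partial>measure_pmf (\<sigma> h))"
    if "s' \<in> states M" for s'
    unfolding step_def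
  proof (rule nn_integral_eq_integral[symmetric])
    show "integrable (measure_pmf (\<sigma> h)) (\<lambda>a. tr M (last h) a s')"
      by (rule measure_pmf.integrable_const_bound[where B = 1])
        (use bnd that in \<open>auto simp: AE_measure_pmf_iff\<close>)
    show "AE a in measure_pmf (\<sigma> h). 0 \<le> tr M (last h) a s'"
      using bnd that by (auto simp: AE_measure_pmf_iff)
  qed
  have cS: "countable (states M)" using M by (simp add: valid_mdp_def)
  have "(\<integral>\<^sup>+ s'. ennreal (step M \<sigma> h s') * f s' \<partial>count_space (states M))
      = (\<integral>\<^sup>+ s'. (\<integral>\<^sup>+ a. ennreal (tr M (last h) a s') * f s' \<partial>measure_pmf (\<sigma> h))
          \<partial>count_space (states M))"
    by (rule nn_integral_cong) (simp add: eq nn_integral_multc)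
  also have "\<dots> = (\<integral>\<^sup>+ a. avg M (last h) a f \<partial>measure_pmf (\<sigma> h))"
    unfolding avg_def
    by (rule nn_integral_count_space_nn_integral[OF cS, symmetric]) simp
  finally show ?thesis .
qed

section \<open>Cylinder sets and hitting probabilities under the path measure\<close>

definition cylinder :: "('s, 'a) mdp \<Rightarrow> 's list \<Rightarrow> (nat \<Rightarrow> 's) set" where
  "cylinder M h = {\<omega> \<in> UNIV \<rightarrow> states M. \<forall>i<length h. \<omega> i = h ! i}"

text \<open>The product formula for cylinders gains exactly one factor when the history grows by one
  state.\<close>

lemma emeasure_cylinder_snoc:
  assumes M: "valid_mdp M" and \<sigma>: "\<sigma> \<in> Sched M" and s: "s \<in> states M"
    and h: "h \<noteq> []" "set h \<subseteq> states M" and y: "y \<in> states M"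
  shows "emeasure (path_measure M \<sigma> s) (cylinder M (h @ [y]))
    = emeasure (path_measure M \<sigma> s) (cylinder M h) * ennreal (step M \<sigma> h y)"
proof -
  obtain n where n: "length h = Suc n" using h(1) by (cases h) auto
  define x where "x i = (h @ [y]) ! i" for i
  have x: "x i \<in> states M" if "i \<le> Suc n" for i
    using that n h y by (auto simp: x_def nth_append less_Suc_eq subset_iff)
  have 1: "cylinder M (h @ [y]) = {\<omega> \<in> UNIV \<rightarrow> states M. \<forall>i\<le>Suc n. \<omega> i = x i}"
    by (auto simp: cylinder_def n x_def less_Suc_eq_le)
  have 2: "cylinder M h = {\<omega> \<in> UNIV \<rightarrow> states M. \<forall>i\<le>n. \<omega> i = x i}"
    by (auto simp: cylinder_def n x_def less_Suc_eq_le nth_append)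
  have 3: "map x [0..<Suc n] = h"
    by (rule nth_equalityI) (auto simp: n x_def nth_append simp del: upt_Suc)
  have "x (Suc n) = y" using n by (simp add: x_def nth_append)
  then show ?thesis
    unfolding 1 2
    by (subst (1 2) emeasure_path_cylinder[OF M \<sigma> s])
      (use x in \<open>auto simp: 3 mult.assoc simp del: upt_Suc\<close>)
qed

lemma emeasure_cylinder_single:
  assumes M: "valid_mdp M" and \<sigma>: "\<sigma> \<in> Sched M" and s: "s \<in> states M" and y: "y \<in> states M"
  shows "emeasure (path_measure M \<sigma> s) (cylinder M [y]) = indicator {s} y"
proof -
  have "cylinder M [y] = {\<omega> \<in> UNIV \<rightarrow> states M. \<forall>i\<le>0. \<omega> i = y}"
    by (auto simp: cylinder_def)
  then show ?thesis
    using emeasure_path_cylinder[OF M \<sigma> s, of 0 "\<lambda>_. y"] y by simp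
qed

lemma measurable_component_path:
  assumes M: "valid_mdp M" and \<sigma>: "\<sigma> \<in> Sched M" and s: "s \<in> states M"
  shows "(\<lambda>\<omega>. \<omega> i) \<in> path_measure M \<sigma> s \<rightarrow>\<^sub>M count_space (states M)"
  by (subst measurable_cong_sets[OF sets_path_measure[OF M \<sigma> s] refl]) measurable

lemma sets_component_path:
  assumes M: "valid_mdp M" and \<sigma>: "\<sigma> \<in> Sched M" and s: "s \<in> states M"
  shows "{\<omega> \<in> UNIV \<rightarrow> states M. \<omega> i \<in> T} \<in> sets (path_measure M \<sigma> s)"
proof -
  have "(\<lambda>\<omega>. \<omega> i) -` (T \<inter> states M) \<inter> space (path_measure M \<sigma> s) \<in> sets (path_measure M \<sigma> s)"
    by (rule measurable_sets[OF measurable_component_path[OF assms]]) simp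
  also have "(\<lambda>\<omega>. \<omega> i) -` (T \<inter> states M) \<inter> space (path_measure M \<sigma> s)
      = {\<omega> \<in> UNIV \<rightarrow> states M. \<omega> i \<in> T}"
    by (auto simp: space_path_measure[OF assms])
  finally show ?thesis .
qed

lemma sets_cylinder:
  assumes M: "valid_mdp M" and \<sigma>: "\<sigma> \<in> Sched M" and s: "s \<in> states M"
  shows "cylinder M h \<in> sets (path_measure M \<sigma> s)"
proof -
  have "cylinder M h = (\<Inter>i<length h. {\<omega> \<in> UNIV \<rightarrow> states M. \<omega> i \<in> {h ! i}})
      \<inter> space (path_measure M \<sigma> s)"
    by (auto simp: cylinder_def space_path_measure[OF assms])
  also have "\<dots> \<in> sets (path_measure M \<sigma> s)"
    by (cases "h = []")
      (auto intro!: sets.Int sets.finite_INT sets_component_path[OF assms] simp del: insert_iff)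
  finally show ?thesis .
qed

lemma sets_reaches:
  assumes M: "valid_mdp M" and \<sigma>: "\<sigma> \<in> Sched M" and s: "s \<in> states M"
  shows "{\<omega> \<in> space (path_measure M \<sigma> s). reaches T \<omega>} \<in> sets (path_measure M \<sigma> s)"
proof -
  have "{\<omega> \<in> space (path_measure M \<sigma> s). reaches T \<omega>} = (\<Union>i. {\<omega> \<in> UNIV \<rightarrow> states M. \<omega> i \<in> T})"
    by (auto simp: reaches_def space_path_measure[OF assms])
  then show ?thesis using sets_component_path[OF assms] by auto
qed

definition reaches_within :: "('s, 'a) mdp \<Rightarrow> 's set \<Rightarrow> nat \<Rightarrow> (nat \<Rightarrow> 's) set" where
  "reaches_within M T n = {\<omega> \<in> UNIV \<rightarrow> states M. \<exists>i\<le>n. \<omega> i \<in> T}"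

lemma sets_reaches_within:
  assumes M: "valid_mdp M" and \<sigma>: "\<sigma> \<in> Sched M" and s: "s \<in> states M"
  shows "reaches_within M T n \<in> sets (path_measure M \<sigma> s)"
proof -
  have "reaches_within M T n = (\<Union>i\<le>n. {\<omega> \<in> UNIV \<rightarrow> states M. \<omega> i \<in> T})"
    by (auto simp: reaches_within_def)
  then show ?thesis using sets_component_path[OF assms] by auto
qed

text \<open>This ties the path measure to the recursion. The current time is
  \<open>length h - 1\<close>, so the horizon is an absolute time; the induction on \<open>k\<close>
  partitions a cylinder by its next state.\<close>

lemma emeasure_cylinder_reaches_within:
  assumes M: "valid_mdp M" and \<sigma>: "\<sigma> \<in> Sched M" and s: "s \<in> states M"
    and h: "h \<noteq> []" "set h \<subseteq> states M" "set (butlast h) \<inter> T = {}"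
  shows "emeasure (path_measure M \<sigma> s) (cylinder M h \<inter> reaches_within M T (length h - 1 + k))
    = emeasure (path_measure M \<sigma> s) (cylinder M h) * reach_val M \<sigma> T k h"
  using h
proof (induction k arbitrary: h)
  case (0 h)
  have l: "last h = h ! (length h - 1)" using 0 by (simp add: last_conv_nth)
  have nT: "h ! i \<notin> T" if "i < length h - 1" for i
    using that 0(3) nth_mem[of i "butlast h"] by (auto simp: nth_butlast)
  show ?case
  proof (cases "last h \<in> T")
    case True
    then have "cylinder M h \<inter> reaches_within M T (length h - 1 + 0) = cylinder M h"
      using 0 l by (auto simp: cylinder_def reaches_within_def)
    then show ?thesis using True by simp
  next
    case False
    have "h ! i \<notin> T" if "i \<le> length h - 1" for i
      using nT[of i] False l that by (cases "i = length h - 1") auto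
    then have "cylinder M h \<inter> reaches_within M T (length h - 1 + 0) = {}"
      using 0(1) by (fastforce simp: cylinder_def reaches_within_def neq_Nil_conv)
    then show ?thesis using False by simp
  qed
next
  case (Suc k h)
  let ?P = "path_measure M \<sigma> s"
  have l: "last h = h ! (length h - 1)" "length h - 1 < length h"
    using Suc.prems(1) by (simp_all add: last_conv_nth)
  show ?case
  proof (cases "last h \<in> T")
    case True
    then have "cylinder M h \<inter> reaches_within M T (length h - 1 + Suc k) = cylinder M h"
      using l by (auto simp: cylinder_def reaches_within_def intro!: exI[of _ "length h - 1"])
    then show ?thesis using True by simp
  next
    case False
    let ?B = "reaches_within M T (length h - 1 + Suc k)"
    have hT: "set h \<inter> T = {}"
      using Suc.prems(1,3) False by (metis Int_insert_left append_butlast_last_id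
          list.set(1,2) set_append Un_insert_right sup_bot_right)
    have cS: "countable (states M)" using M by (simp add: valid_mdp_def)
    \<comment> \<open>Appending a state advances the current time by one and uses up one remaining
      step, so the absolute horizon is unchanged.\<close>
    have len: "length (h @ [y]) - 1 + k = length h - 1 + Suc k" for y
      using Suc.prems(1) by (cases h) auto
    have split: "cylinder M h \<inter> ?B = (\<Union>y\<in>states M. cylinder M (h @ [y]) \<inter> ?B)"
      by (auto simp: cylinder_def nth_append less_Suc_eq)
    have "emeasure ?P (cylinder M h \<inter> ?B)
        = (\<integral>\<^sup>+ y. emeasure ?P (cylinder M (h @ [y]) \<inter> ?B) \<partial>count_space (states M))"
    proof (subst split, rule emeasure_UN_countable)
      show "disjoint_family_on (\<lambda>y. cylinder M (h @ [y]) \<inter> ?B) (states M)"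
        by (auto simp: disjoint_family_on_def cylinder_def nth_append)
    qed (auto intro: cS sets.Int sets_cylinder[OF M \<sigma> s] sets_reaches_within[OF M \<sigma> s])
    also have "\<dots> = (\<integral>\<^sup>+ y. emeasure ?P (cylinder M h) *
        (ennreal (step M \<sigma> h y) * reach_val M \<sigma> T k (h @ [y])) \<partial>count_space (states M))"
    proof (rule nn_integral_cong)
      fix y assume "y \<in> space (count_space (states M))"
      then have y: "y \<in> states M" by simp
      have "emeasure ?P (cylinder M (h @ [y]) \<inter> ?B)
          = emeasure ?P (cylinder M (h @ [y])) * reach_val M \<sigma> T k (h @ [y])"
        using Suc.IH[of "h @ [y]", unfolded len] Suc.prems y hT by simp
      then show "emeasure ?P (cylinder M (h @ [y]) \<inter> ?B) = emeasure ?P (cylinder M h) *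
          (ennreal (step M \<sigma> h y) * reach_val M \<sigma> T k (h @ [y]))"
        using emeasure_cylinder_snoc[OF M \<sigma> s Suc.prems(1,2) y] by (simp add: mult.assoc)
    qed
    also have "\<dots> = emeasure ?P (cylinder M h) * reach_val M \<sigma> T (Suc k) h"
      using step_avg[OF M \<sigma> Suc.prems(1,2), of "\<lambda>y. reach_val M \<sigma> T k (h @ [y])"] False
      by (simp add: nn_integral_cmult)
    finally show ?thesis .
  qed
qed

lemma AE_path_start:
  assumes M: "valid_mdp M" and \<sigma>: "\<sigma> \<in> Sched M" and s: "s \<in> states M"
  shows "AE \<omega> in path_measure M \<sigma> s. \<omega> 0 = s"
proof -
  interpret prob_space "path_measure M \<sigma> s" by (rule prob_space_path_measure[OF assms])
  have "prob (cylinder M [s]) = 1"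
    using emeasure_cylinder_single[OF M \<sigma> s s] by (simp add: measure_def)
  then have "AE \<omega> in path_measure M \<sigma> s. \<omega> \<in> cylinder M [s]"
    by (subst AE_in_set_eq_1) (auto intro: sets_cylinder[OF assms])
  then show ?thesis by eventually_elim (simp add: cylinder_def)
qed

text \<open>Continuity from below along the bounded-horizon events; almost every path lies in the
  cylinder of \<open>[s]\<close>.\<close>

lemma path_prob_reaches:
  assumes M: "valid_mdp M" and \<sigma>: "\<sigma> \<in> Sched M" and s: "s \<in> states M"
  shows "ennreal (path_prob M \<sigma> s (reaches T)) = (SUP k. reach_val M \<sigma> T k [s])"
proof -
  let ?P = "path_measure M \<sigma> s"
  interpret prob_space ?P by (rule prob_space_path_measure[OF assms])
  have eq: "emeasure ?P (reaches_within M T k) = reach_val M \<sigma> T k [s]" for k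
  proof -
    have "emeasure ?P (reaches_within M T k) = emeasure ?P (cylinder M [s] \<inter> reaches_within M T k)"
    proof (rule emeasure_eq_AE)
      show "AE \<omega> in ?P. \<omega> \<in> reaches_within M T k \<longleftrightarrow> \<omega> \<in> cylinder M [s] \<inter> reaches_within M T k"
        using AE_path_start[OF assms]
        by eventually_elim (auto simp: cylinder_def reaches_within_def)
    qed (intro sets.Int sets_cylinder[OF assms] sets_reaches_within[OF assms])+
    also have "\<dots> = reach_val M \<sigma> T k [s]"
      using emeasure_cylinder_reaches_within[OF assms, of "[s]" T k] s
      by (simp add: emeasure_cylinder_single[OF assms s])
    finally show ?thesis .
  qed
  have "{\<omega> \<in> space ?P. reaches T \<omega>} = (\<Union>k. reaches_within M T k)"
    by (auto simp: reaches_def reaches_within_def space_path_measure[OF assms])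
  then have "ennreal (path_prob M \<sigma> s (reaches T)) = emeasure ?P (\<Union>k. reaches_within M T k)"
    by (simp add: path_prob_def emeasure_eq_measure)
  also have "\<dots> = (SUP k. emeasure ?P (reaches_within M T k))"
  proof (rule SUP_emeasure_incseq[symmetric])
    show "incseq (reaches_within M T)"
      by (auto simp: incseq_def reaches_within_def intro: le_trans)
  qed (auto intro: sets_reaches_within[OF assms])
  finally show ?thesis by (simp add: eq)
qed

lemma path_prob_bounds:
  assumes M: "valid_mdp M" and \<sigma>: "\<sigma> \<in> Sched M" and s: "s \<in> states M"
  shows "0 \<le> path_prob M \<sigma> s \<phi>" "path_prob M \<sigma> s \<phi> \<le> 1"
proof -
  interpret prob_space "path_measure M \<sigma> s" by (rule prob_space_path_measure[OF assms])
  show "0 \<le> path_prob M \<sigma> s \<phi>" "path_prob M \<sigma> s \<phi> \<le> 1" by (simp_all add: path_prob_def)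
qed

text \<open>A failure at time \<open>i\<close> puts the path into one of countably many cylinders
  whose last transition has no mass, and each of these is null.\<close>

lemma AE_tr_pos:
  assumes M: "valid_mdp M" and \<sigma>: "\<sigma> \<in> Positional M" and s: "s \<in> states M"
  shows "AE \<omega> in path_measure M (sched_of \<sigma>) s. \<forall>i. 0 < tr M (\<omega> i) (\<sigma> (\<omega> i)) (\<omega> (Suc i))"
proof -
  let ?P = "path_measure M (sched_of \<sigma>) s"
  note \<tau> = sched_of_in_Sched[OF \<sigma>]
  have "AE \<omega> in ?P. 0 < tr M (\<omega> i) (\<sigma> (\<omega> i)) (\<omega> (Suc i))" for i
  proof (rule AE_I')
    let ?X = "{(h, y). h \<in> lists (states M) \<and> length h = Suc i \<and> y \<in> states M \<and>
      tr M (last h) (\<sigma> (last h)) y \<le> 0}"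
    have cS: "countable (states M)" using M by (simp add: valid_mdp_def)
    have "countable (lists (states M) \<times> states M)" using cS by blast
    then have "countable ?X" by (rule countable_subset[rotated]) auto
    then show "(\<Union>(h, y)\<in>?X. cylinder M (h @ [y])) \<in> null_sets ?P"
    proof (rule null_sets_UN')
      fix p assume "p \<in> ?X"
      then obtain h y where p: "p = (h, y)" and h: "h \<in> lists (states M)" "length h = Suc i"
        "y \<in> states M" "tr M (last h) (\<sigma> (last h)) y \<le> 0" by blast
      have "h \<noteq> []" "set h \<subseteq> states M" using h by auto
      then have "emeasure ?P (cylinder M (h @ [y])) = 0"
        using emeasure_cylinder_snoc[OF M \<tau> s _ _ h(3), of h] h(4)
        by (simp add: step_def sched_of_def ennreal_neg)
      then show "(case p of (h, y) \<Rightarrow> cylinder M (h @ [y])) \<in> null_sets ?P"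
        using sets_cylinder[OF M \<tau> s] by (simp add: p null_setsI)
    qed
    show "{\<omega> \<in> space ?P. \<not> 0 < tr M (\<omega> i) (\<sigma> (\<omega> i)) (\<omega> (Suc i))}
        \<subseteq> (\<Union>(h, y)\<in>?X. cylinder M (h @ [y]))"
    proof
      fix \<omega> assume w: "\<omega> \<in> {\<omega> \<in> space ?P. \<not> 0 < tr M (\<omega> i) (\<sigma> (\<omega> i)) (\<omega> (Suc i))}"
      then have w': "\<omega> \<in> UNIV \<rightarrow> states M" by (simp add: space_path_measure[OF M \<tau> s])
      let ?h = "map \<omega> [0..<Suc i]"
      have "?h \<in> lists (states M)" "\<omega> (Suc i) \<in> states M" using w' by (auto simp: Pi_iff)
      then have "(?h, \<omega> (Suc i)) \<in> ?X" using w by auto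
      moreover have "\<omega> \<in> cylinder M (?h @ [\<omega> (Suc i)])"
        using w' by (auto simp: cylinder_def nth_append less_Suc_eq simp del: upt_Suc)
      ultimately show "\<omega> \<in> (\<Union>(h, y)\<in>?X. cylinder M (h @ [y]))" by blast
    qed
  qed
  then show ?thesis by (simp add: AE_all_countable)
qed

section \<open>Positional schedulers for reachability\<close>

text \<open>A supersolution of the Bellman recursion, indexed by the remaining steps, dominates
  every scheduler, because the recursion averages only over enabled actions.\<close>

lemma reach_val_upper:
  assumes M: "valid_mdp M" and \<sigma>: "\<sigma> \<in> Sched M"
    and T: "\<And>k s. s \<in> states M \<Longrightarrow> s \<in> T \<Longrightarrow> 1 \<le> f k s"
    and f: "\<And>k s a. s \<in> states M \<Longrightarrow> s \<notin> T \<Longrightarrow> a \<in> enabled M s \<Longrightarrow> avg M s a (f k) \<le> f (Suc k) s"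
    and h: "h \<noteq> []" "set h \<subseteq> states M"
  shows "reach_val M \<sigma> T k h \<le> f k (last h)"
  using h
proof (induction k arbitrary: h)
  case (0 h)
  then have "last h \<in> states M" by auto
  then show ?case using T by (auto split: split_indicator)
next
  case (Suc k h)
  have l: "last h \<in> states M" using Suc.prems by auto
  show ?case
  proof (cases "last h \<in> T")
    case True
    then show ?thesis using T l by simp
  next
    case False
    have "avg M (last h) a (\<lambda>s'. reach_val M \<sigma> T k (h @ [s'])) \<le> f (Suc k) (last h)"
      if a: "a \<in> set_pmf (\<sigma> h)" for a
    proof -
      have "avg M (last h) a (\<lambda>s'. reach_val M \<sigma> T k (h @ [s'])) \<le> avg M (last h) a (f k)"
        using Suc.IH[of "h @ [_]"] Suc.prems by (intro avg_mono) simp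
      also have "\<dots> \<le> f (Suc k) (last h)"
        using \<sigma> Suc.prems a by (intro f l False) (auto simp: Sched_def)
      finally show ?thesis .
    qed
    then have "(\<integral>\<^sup>+ a. avg M (last h) a (\<lambda>s'. reach_val M \<sigma> T k (h @ [s'])) \<partial>measure_pmf (\<sigma> h))
        \<le> (\<integral>\<^sup>+ a. f (Suc k) (last h) \<partial>measure_pmf (\<sigma> h))"
      by (intro nn_integral_mono_AE) (simp add: AE_measure_pmf_iff)
    then show ?thesis using False by simp
  qed
qed

text \<open>Dual to the upper bound. The step inequality is required only below the horizon
  \<open>n\<close> and only for actions the scheduler plays, so that \<open>f\<close> may itself
  depend on \<open>n\<close>, as it does for slices.\<close>

lemma reach_val_lower:
  assumes T: "\<And>k s. k \<le> n \<Longrightarrow> s \<in> states M \<Longrightarrow> s \<in> T \<Longrightarrow> f k s \<le> 1"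
    and f0: "\<And>s. s \<in> states M \<Longrightarrow> s \<notin> T \<Longrightarrow> f 0 s = 0"
    and f: "\<And>k h a. k < n \<Longrightarrow> h \<noteq> [] \<Longrightarrow> set h \<subseteq> states M \<Longrightarrow> last h \<notin> T \<Longrightarrow> a \<in> set_pmf (\<sigma> h)
      \<Longrightarrow> f (Suc k) (last h) \<le> avg M (last h) a (f k)"
    and h: "h \<noteq> []" "set h \<subseteq> states M" and k: "k \<le> n"
  shows "f k (last h) \<le> reach_val M \<sigma> T k h"
  using h k
proof (induction k arbitrary: h)
  case (0 h)
  then have "last h \<in> states M" by auto
  then show ?case using T[of 0] f0 by (auto split: split_indicator)
next
  case (Suc k h)
  have l: "last h \<in> states M" using Suc.prems by auto
  show ?case
  proof (cases "last h \<in> T")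
    case True
    then show ?thesis using T[of "Suc k"] l Suc.prems by simp
  next
    case False
    have "f (Suc k) (last h) \<le> avg M (last h) a (\<lambda>s'. reach_val M \<sigma> T k (h @ [s']))"
      if a: "a \<in> set_pmf (\<sigma> h)" for a
    proof -
      have "f (Suc k) (last h) \<le> avg M (last h) a (f k)"
        using Suc.prems a False by (intro f) auto
      also have "\<dots> \<le> avg M (last h) a (\<lambda>s'. reach_val M \<sigma> T k (h @ [s']))"
        using Suc.IH[of "h @ [_]"] Suc.prems by (intro avg_mono) simp
      finally show ?thesis .
    qed
    then have "(\<integral>\<^sup>+ a. f (Suc k) (last h) \<partial>measure_pmf (\<sigma> h))
        \<le> (\<integral>\<^sup>+ a. avg M (last h) a (\<lambda>s'. reach_val M \<sigma> T k (h @ [s'])) \<partial>measure_pmf (\<sigma> h))"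
      by (intro nn_integral_mono_AE) (simp add: AE_measure_pmf_iff)
    then show ?thesis using False by simp
  qed
qed

lemma path_prob_positional:
  assumes "valid_mdp M" "\<sigma> \<in> Positional M" "s \<in> states M"
  shows "ennreal (path_prob M (sched_of \<sigma>) s (reaches T)) = (SUP k. pos_val M \<sigma> T k s)"
  using path_prob_reaches[OF assms(1) sched_of_in_Sched[OF assms(2)] assms(3), of T]
  by (simp add: reach_val_sched_of)

lemma pos_val_le_1:
  assumes "valid_mdp M" "\<sigma> \<in> Positional M" "s \<in> states M"
  shows "pos_val M \<sigma> T k s \<le> 1"
proof -
  have "pos_val M \<sigma> T k s \<le> ennreal (path_prob M (sched_of \<sigma>) s (reaches T))"
    unfolding path_prob_positional[OF assms] by (rule SUP_upper) simp
  also have "\<dots> \<le> 1"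
    using path_prob_bounds(2)[OF assms(1) sched_of_in_Sched[OF assms(2)] assms(3)] by simp
  finally show ?thesis .
qed

lemma Positional_nonempty:
  assumes "valid_mdp M" shows "Positional M \<noteq> {}"
proof -
  have "\<forall>s\<in>states M. \<exists>a. a \<in> enabled M s" using assms unfolding valid_mdp_def by blast
  then obtain \<sigma> where "\<forall>s\<in>states M. \<sigma> s \<in> enabled M s" by metis
  then show ?thesis by (auto simp: Positional_def)
qed

text \<open>
  The sink of a collapsed MDP may have infinitely many actions, but all of them have the same
  transition row; this is why finite branching is expressed by rows.
\<close>

definition finite_rows :: "('s, 'a) mdp \<Rightarrow> bool" where
  "finite_rows M \<longleftrightarrow> (\<forall>s\<in>states M. finite (tr M s ` enabled M s))"

lemma finite_avg_image:
  assumes "finite_rows M" "s \<in> states M"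
  shows "finite ((\<lambda>a. avg M s a f) ` enabled M s)"
proof -
  have "(\<lambda>a. avg M s a f) ` enabled M s
      = (\<lambda>r. \<integral>\<^sup>+ s'. ennreal (r s') * f s' \<partial>count_space (states M)) ` tr M s ` enabled M s"
    by (simp add: image_image avg_def)
  then show ?thesis using assms by (simp add: finite_rows_def)
qed

lemma SUP_avg_attained:
  assumes M: "valid_mdp M" "finite_rows M" "s \<in> states M"
  shows "\<exists>a\<in>enabled M s. (SUP a\<in>enabled M s. avg M s a f) = avg M s a f"
proof -
  let ?X = "(\<lambda>a. avg M s a f) ` enabled M s"
  have "enabled M s \<noteq> {}" using M unfolding valid_mdp_def by blast
  then have "Max ?X \<in> ?X" "Sup ?X = Max ?X"
    using finite_avg_image[OF M(2,3)] by (auto intro!: Max_in cSup_eq_Max)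
  then show ?thesis by auto
qed

lemma INF_avg_attained:
  assumes M: "valid_mdp M" "finite_rows M" "s \<in> states M"
  shows "\<exists>a\<in>enabled M s. (INF a\<in>enabled M s. avg M s a f) = avg M s a f"
proof -
  let ?X = "(\<lambda>a. avg M s a f) ` enabled M s"
  have "enabled M s \<noteq> {}" using M unfolding valid_mdp_def by blast
  then have "Min ?X \<in> ?X" "Inf ?X = Min ?X"
    using finite_avg_image[OF M(2,3)] by (auto intro!: Min_in cInf_eq_Min)
  then show ?thesis by auto
qed

text \<open>
  With discount factor \<open>l < 1\<close> every positional scheduler that is greedy for the discounted value
  \<open>w\<close> attains \<open>w\<close>; without discounting, a greedy scheduler may loop forever without progress.
\<close>

lemma positional_discounted:
  assumes M: "valid_mdp M" "finite_rows M" and l: "0 < l" "l < 1"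
  shows "\<exists>\<sigma>\<in>Positional M. \<forall>\<tau>\<in>Sched M. \<forall>s\<in>states M. \<forall>k.
    ennreal (l ^ k) * reach_val M \<tau> T k [s] \<le> ennreal (path_prob M (sched_of \<sigma>) s (reaches T))"
proof -
  \<comment> \<open>This is the Bellman operator of discounted maximal reachability. The value 0 off
    the carrier makes the bound by 1 hold for every \<open>s\<close>.\<close>
  define F where "F w s = (if s \<in> T then 1 else if s \<in> states M then
      ennreal l * (SUP a\<in>enabled M s. avg M s a w) else 0)" for w :: "'a \<Rightarrow> ennreal" and s
  define w where "w = lfp F"
  have "mono F"
    by (intro monoI le_funI) (auto simp: F_def le_fun_def intro!: mult_left_mono SUP_mono' avg_mono)
  then have w: "w s = F w s" for s unfolding w_def by (subst lfp_unfold) auto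
  have w1: "w s \<le> 1" for s
  proof -
    have "F (\<lambda>_. 1) s \<le> 1" for s
    proof -
      have "(SUP a\<in>enabled M s. avg M s a (\<lambda>_. 1)) \<le> 1" if "s \<in> states M"
        using avg_const[OF M(1) that] by (auto intro: SUP_least)
      then have "ennreal l * (SUP a\<in>enabled M s. avg M s a (\<lambda>_. 1)) \<le> 1 * 1" if "s \<in> states M"
        using that l by (intro mult_mono) auto
      then show ?thesis by (simp add: F_def)
    qed
    then have "w \<le> (\<lambda>_. 1)" unfolding w_def by (intro lfp_lowerbound le_funI)
    then show ?thesis by (simp add: le_fun_def)
  qed
  have "\<forall>s\<in>states M. \<exists>a\<in>enabled M s. (SUP a\<in>enabled M s. avg M s a w) = avg M s a w"
    using SUP_avg_attained[OF M] by blast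
  then obtain \<sigma> where \<sigma>: "\<And>s. s \<in> states M \<Longrightarrow> \<sigma> s \<in> enabled M s"
    "\<And>s. s \<in> states M \<Longrightarrow> (SUP a\<in>enabled M s. avg M s a w) = avg M s (\<sigma> s) w"
    by metis
  have \<sigma>P: "\<sigma> \<in> Positional M" using \<sigma>(1) by (simp add: Positional_def)
  \<comment> \<open>Unfolding the greedy choice \<open>k\<close> times leaves an error of at most
    \<open>l ^ k\<close>, starting from \<open>w \<le> 1\<close>. The discount on the main term is
    dropped, as \<open>pos_val\<close> is undiscounted.\<close>
  have low: "w s \<le> pos_val M \<sigma> T k s + ennreal (l ^ k)" if "s \<in> states M" for k s
    using that
  proof (induction k arbitrary: s)
    case 0
    then show ?case using w1[of s] by (simp add: add_increasing)
  next
    case (Suc k)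
    show ?case
    proof (cases "s \<in> T")
      case True
      then show ?thesis using w1[of s] by (simp add: add_increasing2)
    next
      case False
      have "w s = ennreal l * avg M s (\<sigma> s) w"
        using False Suc.prems \<sigma>(2)[OF Suc.prems] by (subst w) (simp add: F_def)
      also have "\<dots> \<le> ennreal l * avg M s (\<sigma> s) (\<lambda>s'. pos_val M \<sigma> T k s' + ennreal (l ^ k))"
        using Suc.IH by (intro mult_left_mono avg_mono) auto
      also have "\<dots> = ennreal l * avg M s (\<sigma> s) (pos_val M \<sigma> T k) + ennreal (l ^ Suc k)"
        using \<sigma>(1)[OF Suc.prems] l
        by (simp add: avg_add avg_const[OF M(1) Suc.prems] distrib_left ennreal_mult)
      also have "\<dots> \<le> 1 * avg M s (\<sigma> s) (pos_val M \<sigma> T k) + ennreal (l ^ Suc k)"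
        using l by (intro add_right_mono mult_right_mono) auto
      finally show ?thesis using False by simp
    qed
  qed
  have w_le: "w s \<le> ennreal (path_prob M (sched_of \<sigma>) s (reaches T))" if s: "s \<in> states M" for s
  proof -
    let ?p = "path_prob M (sched_of \<sigma>) s (reaches T)"
    have p0: "0 \<le> ?p" by (rule path_prob_bounds(1)[OF M(1) sched_of_in_Sched[OF \<sigma>P] s])
    obtain v where v: "w s = ennreal v" "0 \<le> v"
      using w1[of s] by (cases "w s") (auto simp: top_unique)
    have "v \<le> ?p + l ^ k" for k
    proof -
      have "w s \<le> ennreal ?p + ennreal (l ^ k)"
        unfolding path_prob_positional[OF M(1) \<sigma>P s, of T]
        by (rule order_trans[OF low[OF s, of k]]) (intro add_right_mono SUP_upper UNIV_I)
      also have "\<dots> = ennreal (?p + l ^ k)" using p0 l by (intro ennreal_plus[symmetric]) auto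
      finally have "ennreal v \<le> ennreal (?p + l ^ k)" using v(1) by simp
      then show ?thesis using p0 l by (subst (asm) ennreal_le_iff) auto
    qed
    moreover have "(\<lambda>k. ?p + l ^ k) \<longlonglongrightarrow> ?p + 0"
      using l by (intro tendsto_intros LIMSEQ_realpow_zero) auto
    ultimately have "v \<le> ?p + 0" by (intro LIMSEQ_le_const) auto
    then show ?thesis using v by (simp add: ennreal_leI)
  qed
  have up: "ennreal (l ^ k) * reach_val M \<tau> T k [s] \<le> w s"
    if \<tau>: "\<tau> \<in> Sched M" and s: "s \<in> states M" for \<tau> s k
  proof -
    \<comment> \<open>The factor \<open>c\<close> cancels one discount, so \<open>c ^ k * w\<close>
      is a supersolution of the undiscounted recursion.\<close>
    define c where "c = ennreal (1 / l)"
    have cl: "c * ennreal l = 1" using l by (simp add: c_def ennreal_mult[symmetric])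
    have c1: "1 \<le> c" using l by (simp add: c_def)
    have "reach_val M \<tau> T k [s] \<le> c ^ k * w (last [s])"
    proof (rule reach_val_upper[OF M(1) \<tau>])
      fix k s assume "s \<in> T"
      then have "w s = 1" by (subst w) (simp add: F_def)
      then show "1 \<le> c ^ k * w s" using c1 by (simp add: one_le_power)
    next
      fix k s a assume s: "s \<in> states M" "s \<notin> T" and a: "a \<in> enabled M s"
      have "avg M s a (\<lambda>s'. c ^ k * w s') = c ^ k * (c * ennreal l) * avg M s a w"
        by (simp add: avg_cmult cl)
      also have "\<dots> = c ^ Suc k * (ennreal l * avg M s a w)" by (simp add: ac_simps)
      also have "\<dots> \<le> c ^ Suc k * (ennreal l * (SUP a\<in>enabled M s. avg M s a w))"
        using a by (intro mult_left_mono SUP_upper) auto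
      also have "\<dots> = c ^ Suc k * w s" using s w[of s] by (simp add: F_def)
      finally show "avg M s a (\<lambda>s'. c ^ k * w s') \<le> c ^ Suc k * w s" .
    qed (use s in auto)
    then have "ennreal l ^ k * reach_val M \<tau> T k [s] \<le> ennreal l ^ k * (c ^ k * w s)"
      by (simp add: mult_left_mono)
    also have "\<dots> = (c * ennreal l) ^ k * w s" by (simp add: power_mult_distrib ac_simps)
    finally show ?thesis using l by (simp add: cl ennreal_power)
  qed
  show ?thesis
    by (rule bexI[OF _ \<sigma>P]) (use up w_le in \<open>blast intro: order_trans\<close>)
qed

text \<open>First fix a horizon \<open>k\<close> at which \<open>\<tau>\<close> has nearly its full
  value, then a discount so close to 1 that its \<open>k\<close>-th power costs little. The greedy
  scheduler for that discount does the rest.\<close>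

lemma positional_nearly_optimal:
  assumes M: "valid_mdp M" "finite_rows M" and \<tau>: "\<tau> \<in> Sched M" and s: "s \<in> states M"
    and \<epsilon>: "0 < (\<epsilon> :: real)"
  shows "\<exists>\<sigma>\<in>Positional M.
    path_prob M \<tau> s (reaches T) \<le> path_prob M (sched_of \<sigma>) s (reaches T) + \<epsilon>"
proof (cases "path_prob M \<tau> s (reaches T) \<le> \<epsilon>")
  case True
  obtain \<sigma> where "\<sigma> \<in> Positional M" using Positional_nonempty[OF M(1)] by blast
  then show ?thesis
    using True path_prob_bounds(1)[OF M(1) sched_of_in_Sched s, of \<sigma> "reaches T"]
    by (intro bexI[of _ \<sigma>]) auto
next
  case False
  define p where "p = path_prob M \<tau> s (reaches T)"
  have p1: "p \<le> 1" unfolding p_def by (rule path_prob_bounds(2)[OF M(1) \<tau> s])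
  define q where "q = p - \<epsilon> / 2"
  have q: "0 \<le> q" "q < p" "q \<le> 1" using False \<epsilon> p1 by (auto simp: q_def p_def)
  then have "ennreal q < ennreal p" by (simp add: ennreal_less_iff)
  then obtain k where k: "ennreal q < reach_val M \<tau> T k [s]"
    unfolding p_def path_prob_reaches[OF M(1) \<tau> s] less_SUP_iff by blast
  \<comment> \<open>The \<open>min\<close> keeps \<open>1 - d\<close> strictly between 0 and 1;
    \<open>k + 1\<close> keeps the denominator positive for \<open>k = 0\<close>.\<close>
  define d where "d = min (1 / 2) (\<epsilon> / (2 * (real k + 1)))"
  have d: "0 < d" "d < 1" using \<epsilon> by (auto simp: d_def)
  have "real k * d \<le> real k * (\<epsilon> / (2 * (real k + 1)))" by (intro mult_left_mono) (auto simp: d_def)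
  also have "\<dots> \<le> \<epsilon> / 2" using \<epsilon> by (simp add: field_simps)
  finally have kd: "real k * d \<le> \<epsilon> / 2" .
  obtain \<sigma> where \<sigma>: "\<sigma> \<in> Positional M" and
    le: "ennreal ((1 - d) ^ k) * reach_val M \<tau> T k [s] \<le> ennreal (path_prob M (sched_of \<sigma>) s (reaches T))"
    using positional_discounted[OF M, of "1 - d" T] d \<tau> s by (auto simp: Bex_def)
  let ?r = "path_prob M (sched_of \<sigma>) s (reaches T)"
  have "ennreal ((1 - d) ^ k * q) = ennreal ((1 - d) ^ k) * ennreal q"
    using d q by (simp add: ennreal_mult)
  also have "\<dots> \<le> ennreal ((1 - d) ^ k) * reach_val M \<tau> T k [s]"
    using k by (intro mult_left_mono) auto
  also note le
  finally have *: "(1 - d) ^ k * q \<le> ?r"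
    using path_prob_bounds(1)[OF M(1) sched_of_in_Sched[OF \<sigma>] s] by simp
  \<comment> \<open>Bernoulli's inequality bounds the loss from discounting by \<open>k * d\<close>,
    since \<open>q \<le> 1\<close>.\<close>
  have "(1 - real k * d) * q \<le> (1 - d) ^ k * q"
    using Bernoulli_inequality[of "- d" k] d q by (intro mult_right_mono) auto
  moreover have "real k * d * q \<le> real k * d * 1" using q d by (intro mult_left_mono) auto
  ultimately have "q - real k * d \<le> ?r" using * by (simp add: algebra_simps)
  then have "p \<le> ?r + \<epsilon>" using kd by (simp add: q_def)
  then show ?thesis using \<sigma> by (auto simp: p_def)
qed

section \<open>Minimal reachability: value iteration and an optimal positional scheduler\<close>

primrec min_val :: "('s, 'a) mdp \<Rightarrow> 's set \<Rightarrow> nat \<Rightarrow> 's \<Rightarrow> ennreal" where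
  "min_val M T 0 s = indicator T s"
| "min_val M T (Suc k) s = (if s \<in> T then 1 else INF a\<in>enabled M s. avg M s a (min_val M T k))"

lemma min_val_target: "s \<in> T \<Longrightarrow> min_val M T k s = 1"
  by (cases k) auto

lemma incseq_min_val: "incseq (min_val M T)"
proof (rule incseq_SucI)
  show "min_val M T k \<le> min_val M T (Suc k)" for k
  proof (induction k)
    case 0
    show ?case by (auto simp: le_fun_def split: split_indicator)
  next
    case (Suc k)
    show ?case
    proof (rule le_funI)
      fix s
      show "min_val M T (Suc k) s \<le> min_val M T (Suc (Suc k)) s"
      proof (cases "s \<in> T")
        case False
        have "(INF a\<in>enabled M s. avg M s a (min_val M T k))
            \<le> (INF a\<in>enabled M s. avg M s a (min_val M T (Suc k)))"
          using Suc.IH by (intro INF_mono' avg_mono) (simp only: le_fun_def)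
        then show ?thesis using False by simp
      qed simp
    qed
  qed
qed

lemma min_val_le_reach_val:
  assumes \<sigma>: "\<sigma> \<in> Sched M" and s: "s \<in> states M"
  shows "min_val M T k s \<le> reach_val M \<sigma> T k [s]"
proof -
  have "min_val M T k (last [s]) \<le> reach_val M \<sigma> T k [s]"
  proof (rule reach_val_lower[where n = k])
    fix j h a assume h: "h \<noteq> []" "set h \<subseteq> states M" "last h \<notin> T" "a \<in> set_pmf (\<sigma> h)"
    then have "a \<in> enabled M (last h)" using \<sigma> by (auto simp: Sched_def)
    then show "min_val M T (Suc j) (last h) \<le> avg M (last h) a (min_val M T j)"
      using h by (auto intro: INF_lower)
  qed (use s in \<open>auto simp: min_val_target\<close>)
  then show ?thesis by simp
qed

lemma min_val_positional:
  assumes M: "valid_mdp M" "finite_rows M"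
  shows "\<exists>\<sigma>\<in>Positional M. \<forall>s\<in>states M. \<forall>k. pos_val M \<sigma> T k s \<le> (SUP k. min_val M T k s)"
proof -
  define v where "v s = (SUP k. min_val M T k s)" for s
  have v_upper: "min_val M T k s \<le> v s" for k s unfolding v_def by (rule SUP_upper) simp
  have "\<exists>a\<in>enabled M s. s \<notin> T \<longrightarrow> avg M s a v \<le> v s" if s: "s \<in> states M" for s
  proof -
    have "\<forall>k. \<exists>a\<in>enabled M s.
        (INF a\<in>enabled M s. avg M s a (min_val M T k)) = avg M s a (min_val M T k)"
      using INF_avg_attained[OF M s] by blast
    then obtain a where a: "\<And>k. a k \<in> enabled M s"
      "\<And>k. (INF a\<in>enabled M s. avg M s a (min_val M T k)) = avg M s (a k) (min_val M T k)"
      by metis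
    have "finite ((\<lambda>k. tr M s (a k)) ` UNIV)"
      by (rule finite_subset[where B = "tr M s ` enabled M s"])
        (use M(2) s a(1) in \<open>auto simp: finite_rows_def\<close>)
    \<comment> \<open>By pigeonhole, one row is minimizing at infinitely many stages; its action is
      the choice at \<open>s\<close>.\<close>
    then obtain k0 where k0: "infinite {k. tr M s (a k) = tr M s (a k0)}"
      using pigeonhole_infinite[of UNIV "\<lambda>k. tr M s (a k)"] by auto
    have "avg M s (a k0) v \<le> v s" if "s \<notin> T"
    proof -
      have "avg M s (a k0) v = (SUP k. avg M s (a k0) (min_val M T k))"
        unfolding v_def by (rule avg_SUP[OF incseq_min_val])
      also have "\<dots> \<le> v s"
      proof (rule SUP_least)
        fix k
        \<comment> \<open>Values increase with the stage, so stage \<open>k\<close> can be compared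
          with a later stage at which the chosen row is minimizing.\<close>
        obtain j where j: "k < j" "tr M s (a j) = tr M s (a k0)"
          using k0 by (auto simp: infinite_nat_iff_unbounded)
        have "avg M s (a k0) (min_val M T k) \<le> avg M s (a k0) (min_val M T j)"
          using incseq_min_val[of M T] j(1) by (intro avg_mono) (simp add: incseq_def le_fun_def)
        also have "\<dots> = avg M s (a j) (min_val M T j)"
          using avg_cong_row[OF j(2)] by simp
        also have "\<dots> = min_val M T (Suc j) s" using that a(2) by simp
        also have "\<dots> \<le> v s" by (rule v_upper)
        finally show "avg M s (a k0) (min_val M T k) \<le> v s" .
      qed
      finally show ?thesis .
    qed
    then show ?thesis using a(1) by blast
  qed
  then obtain \<sigma> where \<sigma>: "\<And>s. s \<in> states M \<Longrightarrow> \<sigma> s \<in> enabled M s"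
    "\<And>s. s \<in> states M \<Longrightarrow> s \<notin> T \<Longrightarrow> avg M s (\<sigma> s) v \<le> v s"
    by metis
  have "pos_val M \<sigma> T k s \<le> v s" if "s \<in> states M" for k s
    using that
  proof (induction k arbitrary: s)
    case 0
    show ?case using v_upper[of 0 s] by simp
  next
    case (Suc k)
    show ?case
    proof (cases "s \<in> T")
      case True
      then show ?thesis using v_upper[of 0 s] by simp
    next
      case False
      have "avg M s (\<sigma> s) (pos_val M \<sigma> T k) \<le> avg M s (\<sigma> s) v"
        using Suc.IH by (intro avg_mono) simp
      also note \<sigma>(2)[OF Suc.prems False]
      finally show ?thesis using False by simp
    qed
  qed
  then show ?thesis
    using \<sigma>(1) unfolding v_def by (intro bexI[of _ \<sigma>]) (auto simp: Positional_def)
qed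

text \<open>Compactness of a countable product of finite sets by a diagonal argument: nested
  infinite index sets freeze one coordinate of an enumeration of \<open>S\<close> after
  another.\<close>

lemma diagonal_limit:
  fixes f :: "nat \<Rightarrow> 'b \<Rightarrow> 'c"
  assumes S: "countable S" and fin: "\<And>s. s \<in> S \<Longrightarrow> finite (range (\<lambda>n. f n s))"
  shows "\<exists>g. \<forall>F. finite F \<longrightarrow> F \<subseteq> S \<longrightarrow> infinite {n. \<forall>s\<in>F. f n s = g s}"
proof (cases "S = {}")
  case True
  then show ?thesis by auto
next
  case False
  define e where "e = from_nat_into S"
  have e: "e i \<in> S" for i using False by (simp add: e_def from_nat_into)
  have "\<exists>I. \<forall>i. infinite (I i) \<and> (I (Suc i) \<subseteq> I i \<and> (\<exists>c. \<forall>n\<in>I (Suc i). f n (e i) = c))"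
  proof (rule dependent_nat_choice)
    show "\<exists>I :: nat set. infinite I" by (rule exI[of _ UNIV]) simp
    fix I :: "nat set" and i
    assume I: "infinite I"
    have "finite ((\<lambda>n. f n (e i)) ` I)" by (rule finite_subset[OF _ fin[OF e]]) auto
    from pigeonhole_infinite[OF I this] obtain n0 where
      "infinite {n \<in> I. f n (e i) = f n0 (e i)}" by blast
    then show "\<exists>J. infinite J \<and> J \<subseteq> I \<and> (\<exists>c. \<forall>n\<in>J. f n (e i) = c)" by blast
  qed
  then obtain I c where I: "\<And>i. infinite (I i)" "\<And>i. I (Suc i) \<subseteq> I i"
    "\<And>i n. n \<in> I (Suc i) \<Longrightarrow> f n (e i) = c i"
    by metis
  have dec: "I j \<subseteq> I i" if "i \<le> j" for i j
    using lift_Suc_antimono_le[of I, OF I(2) that] .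
  define g where "g s = c (to_nat_on S s)" for s
  show ?thesis
  proof (intro exI allI impI)
    fix F assume F: "finite F" "F \<subseteq> S"
    \<comment> \<open>Coordinate \<open>i\<close> is frozen only on \<open>I (Suc i)\<close>, hence
      the \<open>Suc\<close>; inserting 0 covers an empty \<open>F\<close>.\<close>
    define m where "m = Suc (Max (insert 0 (to_nat_on S ` F)))"
    have "f n s = g s" if n: "n \<in> I m" and s: "s \<in> F" for n s
    proof -
      have es: "e (to_nat_on S s) = s" using S F s by (auto simp: e_def)
      have "to_nat_on S s \<le> Max (insert 0 (to_nat_on S ` F))" using F s by (intro Max_ge) auto
      then have "n \<in> I (Suc (to_nat_on S s))" using n dec[of "Suc (to_nat_on S s)" m] by (auto simp: m_def)
      from I(3)[OF this] show ?thesis by (simp add: es g_def)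
    qed
    then have "I m \<subseteq> {n. \<forall>s\<in>F. f n s = g s}" by blast
    then show "infinite {n. \<forall>s\<in>F. f n s = g s}" using I(1) infinite_super by blast
  qed
qed

section \<open>Merging states into a sink\<close>

lemma avg_sum:
  assumes F: "finite F" "F \<subseteq> states M" "\<And>s'. s' \<in> states M \<Longrightarrow> s' \<notin> F \<Longrightarrow> tr M s a s' = 0"
  shows "avg M s a f = (\<Sum>s'\<in>F. ennreal (tr M s a s') * f s')"
  unfolding avg_def by (rule nn_integral_count_space') (use F in auto)

lemma pos_val_target: "s \<in> T \<Longrightarrow> pos_val M \<sigma> T k s = 1"
  by (cases k) auto

lemma incseq_pos_val: "incseq (pos_val M \<sigma> T)"
proof (rule incseq_SucI)
  show "pos_val M \<sigma> T k \<le> pos_val M \<sigma> T (Suc k)" for k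
  proof (induction k)
    case 0
    show ?case by (auto simp: le_fun_def split: split_indicator)
  next
    case (Suc k)
    have "avg M s (\<sigma> s) (pos_val M \<sigma> T k) \<le> avg M s (\<sigma> s) (pos_val M \<sigma> T (Suc k))" for s
      using Suc.IH by (intro avg_mono) (simp only: le_fun_def)
    then show ?case
      by (subst (1 2) pos_val.simps(2)[abs_def]) (auto simp only: le_fun_def if_True split: if_split)
  qed
qed

text \<open>Collapsing and slicing are both instances: each merges a set \<open>D\<close> into a
  fresh absorbing state \<open>None\<close>, so schedulers and values are compared once for
  both.\<close>

locale sink =
  fixes M :: "('s, 'a) mdp" and D :: "'s set" and N :: "('s option, 'a) mdp"
  assumes M: "valid_mdp M" and fb: "finite_support M" and ne: "acts M \<noteq> {}"
    and states_N: "states N = insert None (Some ` (states M - D))" and D: "D \<subseteq> states M"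
    and acts_N: "acts N = acts M"
    and tr_Some_Some: "\<And>s a s'. tr N (Some s) a (Some s') = tr M s a s'"
    and tr_Some_None: "\<And>s a. tr N (Some s) a None = (\<Sum>\<^sub>\<infinity>s'\<in>D. tr M s a s')"
    and tr_None: "\<And>a s'. tr N None a s' = (if s' = None then 1 else 0)"
begin

lemma valid_N: "valid_mdp N"
  and finite_support_N: "finite_support N"
  and enabled_Some: "s \<in> states M - D \<Longrightarrow> enabled N (Some s) = enabled M s"
  and enabled_None: "enabled N None = acts M"
  using valid_mdp_sink[OF M fb ne states_N D acts_N tr_Some_Some tr_Some_None tr_None] by blast+

lemma None_in_N: "None \<in> states N"
  by (simp add: states_N)

lemma Some_in_N: "Some s \<in> states N \<longleftrightarrow> s \<in> states M - D"
  by (auto simp: states_N)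

lemma avg_None: "avg N None a f = f None"
  by (subst avg_sum[where F = "{None}"]) (auto simp: states_N tr_None)

text \<open>Averaging after merging is averaging before merging with \<open>f\<close> pulled back
  along the map that sends \<open>D\<close> to \<open>None\<close>. Finite support turns the mass of
  \<open>D\<close> into a finite sum.\<close>

lemma avg_Some:
  assumes s: "s \<in> states M" and a: "a \<in> acts M"
  shows "avg N (Some s) a f = avg M s a (\<lambda>s'. if s' \<in> D then f None else f (Some s'))"
proof -
  let ?F = "{s' \<in> states M. tr M s a s' \<noteq> 0}"
  let ?E = "insert None (Some ` (?F - D))"
  have F: "finite ?F" using fb s a by (auto simp: finite_support_def)
  have inf: "(\<Sum>\<^sub>\<infinity>s'\<in>D. tr M s a s') = (\<Sum>s'\<in>D \<inter> ?F. tr M s a s')"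
    by (subst infsum_cong_neutral[where T = "D \<inter> ?F" and g = "tr M s a"]) (use D F in auto)
  have "avg N (Some s) a f = (\<Sum>y\<in>?E. ennreal (tr N (Some s) a y) * f y)"
    using F by (intro avg_sum) (auto simp: states_N tr_Some_Some)
  also have "\<dots> = ennreal (\<Sum>s'\<in>D \<inter> ?F. tr M s a s') * f None
      + (\<Sum>s'\<in>?F - D. ennreal (tr M s a s') * f (Some s'))"
    using F by (subst sum.insert) (auto simp: tr_Some_Some tr_Some_None inf sum.reindex)
  also have "ennreal (\<Sum>s'\<in>D \<inter> ?F. tr M s a s') = (\<Sum>s'\<in>D \<inter> ?F. ennreal (tr M s a s'))"
    using tr_bounds[OF M s a] by (intro sum_ennreal[symmetric]) auto
  also have "\<dots> * f None + (\<Sum>s'\<in>?F - D. ennreal (tr M s a s') * f (Some s'))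
      = (\<Sum>s'\<in>D \<inter> ?F. ennreal (tr M s a s') * (if s' \<in> D then f None else f (Some s')))
      + (\<Sum>s'\<in>?F - D. ennreal (tr M s a s') * (if s' \<in> D then f None else f (Some s')))"
    by (simp add: sum_distrib_right)
  also have "\<dots> = (\<Sum>s'\<in>(D \<inter> ?F) \<union> (?F - D).
      ennreal (tr M s a s') * (if s' \<in> D then f None else f (Some s')))"
    using F by (intro sum.union_disjoint[symmetric]) auto
  also have "(D \<inter> ?F) \<union> (?F - D) = ?F" by auto
  also have "(\<Sum>s'\<in>?F. ennreal (tr M s a s') * (if s' \<in> D then f None else f (Some s')))
      = avg M s a (\<lambda>s'. if s' \<in> D then f None else f (Some s'))"
    using F by (intro avg_sum[symmetric]) auto
  finally show ?thesis .
qed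

text \<open>A merged row is a function of the original row, and the sink has one row although all
  actions are enabled there.\<close>

lemma finite_rows_N:
  assumes "finite_rows M"
  shows "finite_rows N"
  unfolding finite_rows_def
proof
  fix y assume y: "y \<in> states N"
  show "finite (tr N y ` enabled N y)"
  proof (cases y)
    case None
    have "tr N None ` enabled N None \<subseteq> {\<lambda>s'. if s' = None then 1 else 0}"
      by (auto simp: tr_None fun_eq_iff)
    then show ?thesis using finite_subset None by blast
  next
    case (Some s)
    then have s: "s \<in> states M - D" using y by (simp add: Some_in_N)
    have "tr N (Some s) a = case_option (\<Sum>\<^sub>\<infinity>s'\<in>D. tr M s a s') (tr M s a)" for a
      by (auto simp: fun_eq_iff tr_Some_Some tr_Some_None split: option.split)
    then have "tr N (Some s) ` enabled N (Some s)
        = (\<lambda>r. case_option (\<Sum>\<^sub>\<infinity>s'\<in>D. r s') r) ` tr M s ` enabled M s"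
      by (simp add: image_image enabled_Some[OF s])
    then show ?thesis using assms s by (simp add: Some finite_rows_def)
  qed
qed

lemma pos_val_None: "pos_val N \<sigma> T k None = indicator T None"
  by (induction k) (auto simp: avg_None)

lemma Positional_Some:
  "\<sigma> \<in> Positional N \<Longrightarrow> s \<in> states M - D \<Longrightarrow> \<sigma> (Some s) \<in> enabled M s"
  using enabled_Some by (auto simp: Positional_def states_N)

lemma restrict_positional:
  assumes "\<sigma> \<in> Positional M"
  obtains \<sigma>' where "\<sigma>' \<in> Positional N" "\<And>s. \<sigma>' (Some s) = \<sigma> s"
proof -
  obtain a where "a \<in> acts M" using ne by blast
  then have "case_option a \<sigma> \<in> Positional N"
    using assms enabled_Some enabled_None by (auto simp: Positional_def states_N)
  then show ?thesis using that by simp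
qed

text \<open>The choices on \<open>D\<close> are invisible after merging and are filled in from any
  positional scheduler.\<close>

lemma extend_positional:
  assumes "\<sigma> \<in> Positional N"
  obtains \<sigma>' where "\<sigma>' \<in> Positional M" "\<And>s. s \<in> states M - D \<Longrightarrow> \<sigma>' s = \<sigma> (Some s)"
proof -
  obtain \<sigma>0 where "\<sigma>0 \<in> Positional M" using Positional_nonempty[OF M] by blast
  then have "(\<lambda>s. if s \<in> D then \<sigma>0 s else \<sigma> (Some s)) \<in> Positional M"
    using Positional_Some[OF assms] by (simp add: Positional_def)
  then show ?thesis using that by simp
qed

text \<open>A path entering the sink counts either nothing or, when \<open>None\<close> is a target,
  at most 1; in the latter case all of \<open>D\<close> already counts 1 on the right.\<close>

lemma pos_val_sink_le:
  assumes \<sigma>: "\<sigma> \<in> Positional N" "\<And>s. s \<in> states M - D \<Longrightarrow> \<sigma>' s = \<sigma> (Some s)"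
    and T: "\<And>s. s \<in> states M - D \<Longrightarrow> Some s \<in> T \<Longrightarrow> s \<in> T'" "None \<in> T \<Longrightarrow> D \<subseteq> T'"
    and s: "s \<in> states M - D"
  shows "pos_val N \<sigma> T k (Some s) \<le> pos_val M \<sigma>' T' k s"
  using s
proof (induction k arbitrary: s)
  case 0
  then show ?case using T by (auto split: split_indicator)
next
  case (Suc k)
  show ?case
  proof (cases "s \<in> T'")
    case True
    have "pos_val N \<sigma> T (Suc k) (Some s) \<le> 1"
      using Suc.prems Some_in_N by (intro pos_val_le_1[OF valid_N \<sigma>(1)]) simp
    then show ?thesis using True by simp
  next
    case False
    then have "Some s \<notin> T" using T(1) Suc.prems by blast
    moreover have "avg N (Some s) (\<sigma> (Some s)) (pos_val N \<sigma> T k) \<le> avg M s (\<sigma>' s) (pos_val M \<sigma>' T' k)"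
    proof -
      have a: "\<sigma> (Some s) \<in> acts M"
        using Positional_Some[OF \<sigma>(1) Suc.prems] by (rule enabled_in_acts)
      show ?thesis
        unfolding \<sigma>(2)[OF Suc.prems] avg_Some[OF DiffD1[OF Suc.prems] a]
      proof (rule avg_mono)
        fix s' assume s': "s' \<in> states M"
        have "pos_val N \<sigma> T k None \<le> pos_val M \<sigma>' T' k s'" if "s' \<in> D"
          using T(2) that by (cases "None \<in> T") (auto simp: pos_val_None pos_val_target)
        then show "(if s' \<in> D then pos_val N \<sigma> T k None else pos_val N \<sigma> T k (Some s'))
            \<le> pos_val M \<sigma>' T' k s'"
          using Suc.IH s' by simp
      qed
    qed
    ultimately show ?thesis using False by simp
  qed
qed

text \<open>With \<open>None\<close> as a target, the merged MDP credits 1 for entering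
  \<open>D\<close>, which bounds whatever would happen from there.\<close>

lemma pos_val_sink_ge:
  assumes \<sigma>: "\<sigma> \<in> Positional N" "\<sigma>' \<in> Positional M" "\<And>s. s \<in> states M - D \<Longrightarrow> \<sigma>' s = \<sigma> (Some s)"
    and T: "\<And>s. s \<in> states M - D \<Longrightarrow> s \<in> T' \<Longrightarrow> Some s \<in> T" "None \<in> T"
    and s: "s \<in> states M - D"
  shows "pos_val M \<sigma>' T' k s \<le> pos_val N \<sigma> T k (Some s)"
  using s
proof (induction k arbitrary: s)
  case 0
  then show ?case using T by (auto split: split_indicator)
next
  case (Suc k)
  note le1 = pos_val_le_1[OF M \<sigma>(2)]
  show ?case
  proof (cases "Some s \<in> T")
    case True
    then show ?thesis using le1[of s T' "Suc k"] Suc.prems by simp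
  next
    case False
    then have "s \<notin> T'" using T(1) Suc.prems by blast
    moreover have "avg M s (\<sigma>' s) (pos_val M \<sigma>' T' k) \<le> avg N (Some s) (\<sigma> (Some s)) (pos_val N \<sigma> T k)"
    proof -
      have a: "\<sigma> (Some s) \<in> acts M"
        using Positional_Some[OF \<sigma>(1) Suc.prems] by (rule enabled_in_acts)
      show ?thesis
        unfolding \<sigma>(3)[OF Suc.prems] avg_Some[OF DiffD1[OF Suc.prems] a]
      proof (rule avg_mono)
        fix s' assume "s' \<in> states M"
        then show "pos_val M \<sigma>' T' k s'
            \<le> (if s' \<in> D then pos_val N \<sigma> T k None else pos_val N \<sigma> T k (Some s'))"
          using Suc.IH T(2) le1[of s' T' k] by (simp add: pos_val_None)
      qed
    qed
    ultimately show ?thesis using False by simp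
  qed
qed

lemma path_prob_sink_le:
  assumes \<sigma>: "\<sigma> \<in> Positional N" "\<sigma>' \<in> Positional M" "\<And>s. s \<in> states M - D \<Longrightarrow> \<sigma>' s = \<sigma> (Some s)"
    and T: "\<And>s. s \<in> states M - D \<Longrightarrow> Some s \<in> T \<Longrightarrow> s \<in> T'" "None \<in> T \<Longrightarrow> D \<subseteq> T'"
    and s: "s \<in> states M - D"
  shows "path_prob N (sched_of \<sigma>) (Some s) (reaches T) \<le> path_prob M (sched_of \<sigma>') s (reaches T')"
proof -
  have "ennreal (path_prob N (sched_of \<sigma>) (Some s) (reaches T))
      \<le> ennreal (path_prob M (sched_of \<sigma>') s (reaches T'))"
    using s Some_in_N path_prob_positional[OF valid_N \<sigma>(1), of "Some s" T]
      path_prob_positional[OF M \<sigma>(2), of s T']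
    by (auto intro!: SUP_mono' pos_val_sink_le[OF \<sigma>(1,3) T])
  then show ?thesis
    using path_prob_bounds(1)[OF M sched_of_in_Sched[OF \<sigma>(2)]] s by (subst (asm) ennreal_le_iff) auto
qed

lemma path_prob_sink_ge:
  assumes \<sigma>: "\<sigma> \<in> Positional N" "\<sigma>' \<in> Positional M" "\<And>s. s \<in> states M - D \<Longrightarrow> \<sigma>' s = \<sigma> (Some s)"
    and T: "\<And>s. s \<in> states M - D \<Longrightarrow> s \<in> T' \<Longrightarrow> Some s \<in> T" "None \<in> T"
    and s: "s \<in> states M - D"
  shows "path_prob M (sched_of \<sigma>') s (reaches T') \<le> path_prob N (sched_of \<sigma>) (Some s) (reaches T)"
proof -
  have "ennreal (path_prob M (sched_of \<sigma>') s (reaches T'))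
      \<le> ennreal (path_prob N (sched_of \<sigma>) (Some s) (reaches T))"
    using s Some_in_N path_prob_positional[OF valid_N \<sigma>(1), of "Some s" T]
      path_prob_positional[OF M \<sigma>(2), of s T']
    by (auto intro!: SUP_mono' pos_val_sink_ge[OF \<sigma> T])
  then show ?thesis
    using path_prob_bounds(1)[OF valid_N sched_of_in_Sched[OF \<sigma>(1)]] s Some_in_N
    by (subst (asm) ennreal_le_iff) auto
qed

end

section \<open>Reachable layers, and collapse and slice as instances of merging\<close>

lemma reach_within_subset: "s0 \<in> states M \<Longrightarrow> reach_within M s0 n \<subseteq> states M"
  by (induction n) auto

lemma reach_within_mono: "m \<le> n \<Longrightarrow> reach_within M s0 m \<subseteq> reach_within M s0 n"
  by (rule lift_Suc_mono_le[of "reach_within M s0"]) auto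

lemma reach_within_start: "s0 \<in> reach_within M s0 n"
  using reach_within_mono[of 0 n M s0] by auto

lemma reach_within_step:
  "s \<in> reach_within M s0 n \<Longrightarrow> s' \<in> states M \<Longrightarrow> a \<in> acts M \<Longrightarrow> 0 < tr M s a s'
    \<Longrightarrow> s' \<in> reach_within M s0 (Suc n)"
  by auto

lemma finite_reach_within:
  assumes M: "valid_mdp M" "finite_rows M" "finite_support M" and s0: "s0 \<in> states M"
  shows "finite (reach_within M s0 n)"
proof (induction n)
  case (Suc n)
  have "finite {s' \<in> states M. \<exists>a\<in>acts M. tr M s a s' > 0}" if s: "s \<in> states M" for s
  proof -
    \<comment> \<open>Layers range over all of \<open>acts M\<close>, possibly an infinite set. A
      positive entry rules out row sum 0, so the action is enabled and only finitely many rows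
      occur.\<close>
    have "a \<in> enabled M s" if a: "a \<in> acts M" "s' \<in> states M" "tr M s a s' > 0" for a s'
    proof (rule ccontr)
      assume "a \<notin> enabled M s"
      then have "(tr M s a has_sum 0) (states M)"
        using M(1) s a by (auto simp: enabled_def valid_mdp_def)
      then have "tr M s a s' = 0"
        using tr_bounds(1)[OF M(1) s a(1)] a(2)
        by (intro nonneg_has_sum_le_0D[where a = 0 and A = "states M"]) auto
      then show False using a by simp
    qed
    then have "{s' \<in> states M. \<exists>a\<in>acts M. tr M s a s' > 0}
        \<subseteq> (\<Union>r\<in>tr M s ` enabled M s. {s' \<in> states M. r s' \<noteq> 0})" by fastforce
    moreover have "finite (\<Union>r\<in>tr M s ` enabled M s. {s' \<in> states M. r s' \<noteq> 0})"
    proof (rule finite_UN_I)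
      show "finite (tr M s ` enabled M s)" using M(2) s by (simp add: finite_rows_def)
      show "finite {s' \<in> states M. r s' \<noteq> 0}" if "r \<in> tr M s ` enabled M s" for r
        using that M(3) s by (auto simp: finite_support_def enabled_def)
    qed
    ultimately show ?thesis using finite_subset by blast
  qed
  then have fin: "finite (\<Union>s\<in>reach_within M s0 n. {s' \<in> states M. \<exists>a\<in>acts M. tr M s a s' > 0})"
    using Suc.IH reach_within_subset[OF s0, of n] by blast
  have "reach_within M s0 (Suc n) \<subseteq> reach_within M s0 n \<union>
      (\<Union>s\<in>reach_within M s0 n. {s' \<in> states M. \<exists>a\<in>acts M. tr M s a s' > 0})"
    by auto
  then show ?case using finite_UnI[OF Suc.IH fin] by (rule finite_subset)
qed simp

lemma sink_slice:
  assumes "valid_mdp M" "finite_support M" "acts M \<noteq> {}" "s0 \<in> states M"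
  shows "sink M (states M - reach_within M s0 n) (slice M s0 n)"
proof
  have "states M - (states M - reach_within M s0 n) = reach_within M s0 n"
    using reach_within_subset[OF assms(4), of n] by blast
  then show "states (slice M s0 n) = insert None (Some ` (states M - (states M - reach_within M s0 n)))"
    by (simp only: slice_def mdp.select_convs)
qed (use assms in \<open>auto simp: slice_def\<close>)

lemma sink_collapse:
  assumes "valid_mdp M" "finite_support M" "acts M \<noteq> {}"
  shows "sink M (Avoid_opt opt M G) (collapse opt M G)"
  by unfold_locales (use assms in \<open>auto simp: collapse_def Avoid_opt_def\<close>)

section \<open>Escaping every slice\<close>

lemma ennreal_SUP_approx:
  fixes f :: "nat \<Rightarrow> 'b \<Rightarrow> ennreal"
  assumes f: "incseq f" and p: "ennreal p \<le> (SUP k. f k s)" and \<epsilon>: "0 < \<epsilon>"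
  shows "\<exists>k. \<forall>n\<ge>k. ennreal (p - \<epsilon>) \<le> f n s"
proof (cases "p \<le> \<epsilon>")
  case True
  then show ?thesis by (simp add: ennreal_neg)
next
  case False
  then have "ennreal (p - \<epsilon>) < ennreal p" using \<epsilon> by (simp add: ennreal_less_iff)
  also note p
  finally obtain k where "ennreal (p - \<epsilon>) < f k s" unfolding less_SUP_iff by blast
  then show ?thesis
    using f by (intro exI[of _ k]) (auto simp: incseq_def le_fun_def intro: less_imp_le order_trans)
qed

section \<open>Monotonicity and bounds for optimal probabilities\<close>

lemma path_prob_reaches_mono:
  assumes M: "valid_mdp M" "\<sigma> \<in> Sched M" "s \<in> states M" and T: "T \<subseteq> T'"
  shows "path_prob M \<sigma> s (reaches T) \<le> path_prob M \<sigma> s (reaches T')"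
proof -
  interpret prob_space "path_measure M \<sigma> s" by (rule prob_space_path_measure[OF M])
  show ?thesis
    unfolding path_prob_def
    by (rule finite_measure_mono[OF _ sets_reaches[OF M]]) (use T in \<open>auto simp: reaches_def\<close>)
qed

lemma Sched_nonempty: "valid_mdp M \<Longrightarrow> Sched M \<noteq> {}"
  using Positional_nonempty[of M] sched_of_in_Sched by blast

lemma opt_prob_Sup_upper:
  assumes "valid_mdp M" "\<sigma> \<in> Sched M" "s \<in> states M"
  shows "path_prob M \<sigma> s \<phi> \<le> opt_prob OptSup M s \<phi>"
  unfolding opt_prob.simps
  by (rule cSUP_upper[OF assms(2)])
    (use path_prob_bounds(2)[OF assms(1) _ assms(3)] in \<open>auto intro!: bdd_aboveI2[where M = 1]\<close>)

lemma opt_prob_Inf_lower: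
  assumes "valid_mdp M" "\<sigma> \<in> Sched M" "s \<in> states M"
  shows "opt_prob OptInf M s \<phi> \<le> path_prob M \<sigma> s \<phi>"
  unfolding opt_prob.simps
  by (rule cINF_lower[OF _ assms(2)])
    (use path_prob_bounds(1)[OF assms(1) _ assms(3)] in \<open>auto intro!: bdd_belowI2[where m = 0]\<close>)

lemma opt_prob_reaches_mono:
  assumes M: "valid_mdp M" "s \<in> states M" and T: "T \<subseteq> T'"
  shows "opt_prob opt M s (reaches T) \<le> opt_prob opt M s (reaches T')"
proof (cases opt)
  case OptInf
  show ?thesis
    unfolding OptInf opt_prob.simps
  proof (rule cINF_greatest[OF Sched_nonempty[OF M(1)]])
    fix \<sigma> assume \<sigma>: "\<sigma> \<in> Sched M"
    show "(INF \<sigma>\<in>Sched M. path_prob M \<sigma> s (reaches T)) \<le> path_prob M \<sigma> s (reaches T')"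
      using opt_prob_Inf_lower[OF M(1) \<sigma> M(2), of "reaches T"] path_prob_reaches_mono[OF M(1) \<sigma> M(2) T]
      by simp
  qed
next
  case OptSup
  show ?thesis
    unfolding OptSup opt_prob.simps
  proof (rule cSUP_least[OF Sched_nonempty[OF M(1)]])
    fix \<sigma> assume \<sigma>: "\<sigma> \<in> Sched M"
    show "path_prob M \<sigma> s (reaches T) \<le> (SUP \<sigma>\<in>Sched M. path_prob M \<sigma> s (reaches T'))"
      using opt_prob_Sup_upper[OF M(1) \<sigma> M(2), of "reaches T'"] path_prob_reaches_mono[OF M(1) \<sigma> M(2) T]
      by simp
  qed
qed

text \<open>The first state outside layer \<open>m\<close> is one step away from layer
  \<open>m\<close>, hence in layer \<open>Suc m\<close>.\<close>

lemma diverges_if_unbounded: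
  assumes \<omega>: "\<omega> \<in> UNIV \<rightarrow> states M" "\<omega> 0 = s0" and \<sigma>: "\<sigma> \<in> Positional M"
    and pos: "\<And>i. 0 < tr M (\<omega> i) (\<sigma> (\<omega> i)) (\<omega> (Suc i))"
    and unb: "\<And>m. \<exists>i. \<omega> i \<notin> reach_within M s0 m"
  shows "diverges M s0 \<omega>"
  unfolding diverges_def
proof
  fix m
  define i where "i = (LEAST i. \<omega> i \<notin> reach_within M s0 m)"
  have i: "\<omega> i \<notin> reach_within M s0 m" unfolding i_def by (rule LeastI_ex[OF unb])
  then obtain j where j: "i = Suc j"
    using \<omega>(2) reach_within_start[of s0 M m] by (cases i) auto
  then have "j < (LEAST i. \<omega> i \<notin> reach_within M s0 m)" by (simp add: i_def[symmetric])
  then have "\<omega> j \<in> reach_within M s0 m" using not_less_Least by blast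
  moreover have w: "\<omega> i \<in> states M" for i using \<omega>(1) by (auto simp: Pi_iff)
  moreover have "\<sigma> (\<omega> j) \<in> acts M"
    using \<sigma> w[of j] by (auto simp: Positional_def intro: enabled_in_acts)
  ultimately have "\<omega> i \<in> reach_within M s0 (Suc m)"
    unfolding j using pos by (intro reach_within_step)
  then show "reaches (reach_within M s0 (Suc m) - reach_within M s0 m) \<omega>"
    using i by (auto simp: reaches_def)
qed

lemma sets_diverges:
  assumes M: "valid_mdp M" "\<sigma> \<in> Sched M" "s \<in> states M"
  shows "{\<omega> \<in> space (path_measure M \<sigma> s). diverges M s0 \<omega>} \<in> sets (path_measure M \<sigma> s)"
proof -
  have "{\<omega> \<in> space (path_measure M \<sigma> s). diverges M s0 \<omega>} = (\<Inter>n. {\<omega> \<in> space (path_measure M \<sigma> s).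
      reaches (reach_within M s0 (Suc n) - reach_within M s0 n) \<omega>})"
    unfolding diverges_def by blast
  also have "\<dots> \<in> sets (path_measure M \<sigma> s)"
    by (rule sets.countable_INT) (auto intro: sets_reaches[OF M])
  finally show ?thesis .
qed

text \<open>Continuity from above. A path that misses \<open>g\<close> but lies in every escape
  event leaves all layers and so diverges; decisiveness also makes it reach \<open>A\<close>, and
  both together have probability 0. \<open>A\<close> will be an avoid set for the supremum and the
  sink for the infimum.\<close>

lemma tendsto_escape_prob:
  assumes M: "valid_mdp M" and \<sigma>: "\<sigma> \<in> Positional M" and s0: "s0 \<in> states M"
    and dec: "path_prob M (sched_of \<sigma>) s0 (reaches ({g} \<union> A)) = 1"
    and nf: "path_prob M (sched_of \<sigma>) s0 (\<lambda>\<omega>. diverges M s0 \<omega> \<and> reaches A \<omega>) = 0"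
  shows "(\<lambda>m. path_prob M (sched_of \<sigma>) s0 (reaches ({g} \<union> (states M - reach_within M s0 m))))
    \<longlonglongrightarrow> path_prob M (sched_of \<sigma>) s0 (reaches {g})"
proof -
  let ?P = "path_measure M (sched_of \<sigma>) s0"
  note S = sched_of_in_Sched[OF \<sigma>]
  note R = sets_reaches[OF M S s0]
  interpret prob_space ?P by (rule prob_space_path_measure[OF M S s0])
  define B where "B m = {\<omega> \<in> space ?P. reaches ({g} \<union> (states M - reach_within M s0 m)) \<omega>}" for m
  have B: "B m \<in> events" for m unfolding B_def by (rule R)
  have "(\<lambda>m. prob (B m)) \<longlonglongrightarrow> prob (\<Inter>m. B m)"
  proof (rule finite_Lim_measure_decseq)
    show "decseq B"
      using reach_within_mono[of _ _ M s0] by (fastforce simp: decseq_def B_def reaches_def)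
  qed (use B in auto)
  moreover have "prob (\<Inter>m. B m) = prob {\<omega> \<in> space ?P. reaches {g} \<omega>}"
  proof (rule measure_eq_AE)
    have 1: "AE \<omega> in ?P. reaches ({g} \<union> A) \<omega>"
      using dec unfolding path_prob_def by (simp only: prob_Collect_eq_1[OF R])
    have "{\<omega> \<in> space ?P. diverges M s0 \<omega> \<and> reaches A \<omega>} \<in> events"
      using sets_diverges[OF M S s0] R by (rule sets.sets_Collect_conj[rotated])
    then have 2: "AE \<omega> in ?P. \<not> (diverges M s0 \<omega> \<and> reaches A \<omega>)"
      using nf unfolding path_prob_def by (simp only: prob_Collect_eq_0)
    show "AE \<omega> in ?P. \<omega> \<in> (\<Inter>m. B m) \<longleftrightarrow> \<omega> \<in> {\<omega> \<in> space ?P. reaches {g} \<omega>}"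
      using 1 2 AE_path_start[OF M S s0] AE_tr_pos[OF M \<sigma> s0] AE_space
    proof eventually_elim
      case (elim \<omega>)
      have w: "\<omega> \<in> UNIV \<rightarrow> states M" using elim(5) by (simp add: space_path_measure[OF M S s0])
      have "reaches {g} \<omega>" if "\<And>m. \<omega> \<in> B m"
      proof (rule ccontr)
        assume ng: "\<not> reaches {g} \<omega>"
        then have "\<exists>i. \<omega> i \<notin> reach_within M s0 m" for m
          using that[of m] by (auto simp: B_def reaches_def)
        then have "diverges M s0 \<omega>"
          using diverges_if_unbounded[OF w elim(3) \<sigma>] elim(4) by blast
        moreover have "reaches A \<omega>" using elim(1) ng by (auto simp: reaches_def)
        ultimately show False using elim(2) by blast
      qed
      then show ?case using elim(5) by (auto simp: B_def reaches_def)
    qed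
  qed (use B R in auto)
  ultimately show ?thesis by (simp add: path_prob_def B_def)
qed

text \<open>A path absorbed at time \<open>i\<close> stays within layer \<open>i\<close> forever, so
  it never enters the next layer.\<close>

lemma (in sink) not_diverges_after_None:
  assumes \<sigma>: "\<sigma> \<in> Positional N" and s0: "s0 \<in> states N"
  shows "path_prob N (sched_of \<sigma>) s0 (\<lambda>\<omega>. diverges N s0 \<omega> \<and> reaches {None} \<omega>) = 0"
proof -
  let ?P = "path_measure N (sched_of \<sigma>) s0"
  note S = sched_of_in_Sched[OF \<sigma>]
  interpret prob_space ?P by (rule prob_space_path_measure[OF valid_N S s0])
  have "{\<omega> \<in> space ?P. diverges N s0 \<omega> \<and> reaches {None} \<omega>} \<in> events"
    using sets_diverges[OF valid_N S s0] sets_reaches[OF valid_N S s0]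
    by (rule sets.sets_Collect_conj[rotated])
  moreover have "AE \<omega> in ?P. \<not> (diverges N s0 \<omega> \<and> reaches {None} \<omega>)"
    using AE_path_start[OF valid_N S s0] AE_tr_pos[OF valid_N \<sigma> s0] AE_space
  proof eventually_elim
    case (elim \<omega>)
    have w: "\<omega> i \<in> states N" for i
      using elim(3) by (auto simp: space_path_measure[OF valid_N S s0])
    show ?case
    proof
      assume *: "diverges N s0 \<omega> \<and> reaches {None} \<omega>"
      then obtain i where i: "\<omega> i = None" by (auto simp: reaches_def)
      have after: "\<omega> (i + j) = None" for j
      proof (induction j)
        case (Suc j)
        have "0 < tr N None (\<sigma> None) (\<omega> (Suc (i + j)))" using elim(2) Suc.IH by metis
        then show ?case by (simp add: tr_None split: if_splits)
      qed (simp add: i)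
      have before: "\<omega> j \<in> reach_within N s0 j" for j
      proof (induction j)
        case (Suc j)
        have "\<sigma> (\<omega> j) \<in> acts N" using \<sigma> w enabled_in_acts by (fastforce simp: Positional_def)
        then show ?case using Suc.IH w elim(2) by (intro reach_within_step) auto
      qed (simp add: elim(1))
      have "\<omega> j \<in> reach_within N s0 i" for j
      proof (cases "j \<le> i")
        case True
        then show ?thesis using before[of j] reach_within_mono[of j i N s0] by blast
      next
        case False
        then show ?thesis using after[of "j - i"] before[of i] i by simp
      qed
      then have "\<not> reaches (reach_within N s0 (Suc i) - reach_within N s0 i) \<omega>"
        by (auto simp: reaches_def)
      then show False using * unfolding diverges_def by blast
    qed
  qed
  ultimately show ?thesis unfolding path_prob_def by (simp only: prob_Collect_eq_0)
qed

text \<open>The limit is taken over rows, since enabled actions may be infinitely many at a sink.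
  Every limit row is some \<open>\<sigma> n\<close> row and therefore comes from an enabled
  action.\<close>

lemma limit_positional:
  fixes \<sigma> :: "nat \<Rightarrow> 's \<Rightarrow> 'a"
  assumes M: "valid_mdp M" "finite_rows M" and \<sigma>: "\<And>n. \<sigma> n \<in> Positional M"
  obtains \<rho> where "\<rho> \<in> Positional M"
    "\<And>F. finite F \<Longrightarrow> F \<subseteq> states M \<Longrightarrow> infinite {n. \<forall>s\<in>F. tr M s (\<sigma> n s) = tr M s (\<rho> s)}"
proof -
  have c: "countable (states M)" using M by (simp add: valid_mdp_def)
  have fin: "finite (range (\<lambda>n. tr M s (\<sigma> n s)))" if "s \<in> states M" for s
    by (rule finite_subset[where B = "tr M s ` enabled M s"])
      (use M(2) \<sigma> that in \<open>auto simp: finite_rows_def Positional_def\<close>)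
  obtain g where g: "\<And>F. finite F \<Longrightarrow> F \<subseteq> states M
      \<Longrightarrow> infinite {n. \<forall>s\<in>F. tr M s (\<sigma> n s) = g s}"
    using diagonal_limit[where f = "\<lambda>n s. tr M s (\<sigma> n s)", OF c fin] by blast
  have "\<exists>a\<in>enabled M s. tr M s a = g s" if s: "s \<in> states M" for s
  proof -
    have "infinite {n. tr M s (\<sigma> n s) = g s}" using g[of "{s}"] s by simp
    then obtain n where "tr M s (\<sigma> n s) = g s" using not_finite_existsD by blast
    then show ?thesis using \<sigma>[of n] s by (auto simp: Positional_def)
  qed
  then obtain \<rho> where \<rho>: "\<And>s. s \<in> states M \<Longrightarrow> \<rho> s \<in> enabled M s"
    "\<And>s. s \<in> states M \<Longrightarrow> tr M s (\<rho> s) = g s" by metis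
  show ?thesis
  proof (rule that[of \<rho>])
    fix F assume F: "finite F" "F \<subseteq> states M"
    have "{n. \<forall>s\<in>F. tr M s (\<sigma> n s) = tr M s (\<rho> s)} = {n. \<forall>s\<in>F. tr M s (\<sigma> n s) = g s}"
      using F \<rho> by (auto simp: subset_iff)
    then show "infinite {n. \<forall>s\<in>F. tr M s (\<sigma> n s) = tr M s (\<rho> s)}" using g[OF F] by simp
  qed (use \<rho> in \<open>simp add: Positional_def\<close>)
qed

text \<open>The recursion stops at \<open>T\<close>, so choices made there are irrelevant. With the
  complement of a layer inside \<open>T\<close>, only choices in that layer matter.\<close>

lemma path_prob_cong_rows:
  assumes M: "valid_mdp M" and \<sigma>: "\<sigma> \<in> Positional M" "\<rho> \<in> Positional M" and s: "s \<in> states M"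
    and rows: "\<And>s. s \<in> states M \<Longrightarrow> s \<notin> T \<Longrightarrow> tr M s (\<sigma> s) = tr M s (\<rho> s)"
  shows "path_prob M (sched_of \<sigma>) s (reaches T) = path_prob M (sched_of \<rho>) s (reaches T)"
proof -
  have "pos_val M \<sigma> T k s = pos_val M \<rho> T k s" if "s \<in> states M" for k s
    using that
  proof (induction k arbitrary: s)
    case (Suc k)
    have "avg M s (\<sigma> s) (pos_val M \<sigma> T k) = avg M s (\<rho> s) (pos_val M \<rho> T k)" if "s \<notin> T"
      using Suc.IH avg_cong_row[OF rows[OF Suc.prems that]] avg_cong[of M s "\<rho> s"] by metis
    then show ?case by simp
  qed simp
  then have "ennreal (path_prob M (sched_of \<sigma>) s (reaches T))
      = ennreal (path_prob M (sched_of \<rho>) s (reaches T))"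
    using s by (simp add: path_prob_positional[OF M _ s] \<sigma>)
  then show ?thesis
    using path_prob_bounds(1)[OF M sched_of_in_Sched s] \<sigma> by simp
qed

section \<open>Comparing an MDP with its slices\<close>

locale sliced =
  fixes N :: "('s, 'a) mdp" and s0 g :: 's
  assumes N: "valid_mdp N" and rows: "finite_rows N" and supp: "finite_support N"
    and acts: "acts N \<noteq> {}" and s0: "s0 \<in> states N"
begin

abbreviation "K \<equiv> slice N s0"
abbreviation "R \<equiv> reach_within N s0"

sublocale K: sink N "states N - R n" "K n" for n
  by (rule sink_slice[OF N supp acts s0])

lemma start: "s0 \<in> states N - (states N - R n)" "Some s0 \<in> states (K n)"
  using s0 reach_within_start[of s0 N n] K.Some_in_N by auto

lemma escape_prob_slice_le:
  assumes "\<sigma>' \<in> Positional (K n)" "\<sigma> \<in> Positional N" "\<And>s. s \<in> R n \<Longrightarrow> \<sigma> s = \<sigma>' (Some s)"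
  shows "path_prob (K n) (sched_of \<sigma>') (Some s0) (reaches {Some g, None})
    \<le> path_prob N (sched_of \<sigma>) s0 (reaches ({g} \<union> (states N - R n)))"
  by (rule K.path_prob_sink_le) (use assms start in auto)

lemma slice_sup_upper:
  assumes "0 < \<epsilon>"
  shows "\<exists>\<sigma>\<in>Positional N. opt_prob OptSup (K n) (Some s0) (reaches {Some g, None})
    \<le> path_prob N (sched_of \<sigma>) s0 (reaches ({g} \<union> (states N - R n))) + \<epsilon>"
proof -
  let ?q = "opt_prob OptSup (K n) (Some s0) (reaches {Some g, None})"
  \<comment> \<open>Half of the error goes to approaching the supremum, half to replacing the
    scheduler by a positional one.\<close>
  have "?q - \<epsilon> / 2 < (SUP \<tau>\<in>Sched (K n). path_prob (K n) \<tau> (Some s0) (reaches {Some g, None}))"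
    using assms by simp
  then obtain \<tau> where \<tau>: "\<tau> \<in> Sched (K n)"
    "?q - \<epsilon> / 2 < path_prob (K n) \<tau> (Some s0) (reaches {Some g, None})"
    using less_cSUP_iff[OF Sched_nonempty[OF K.valid_N]]
      path_prob_bounds(2)[OF K.valid_N _ start(2)]
    by (metis (no_types, lifting) bdd_aboveI2)
  obtain \<sigma>' where \<sigma>': "\<sigma>' \<in> Positional (K n)" "path_prob (K n) \<tau> (Some s0) (reaches {Some g, None})
      \<le> path_prob (K n) (sched_of \<sigma>') (Some s0) (reaches {Some g, None}) + \<epsilon> / 2"
    using positional_nearly_optimal[OF K.valid_N K.finite_rows_N[OF rows] \<tau>(1) start(2), of "\<epsilon> / 2"] assms
    by auto
  obtain \<sigma> where \<sigma>: "\<sigma> \<in> Positional N" "\<And>s. s \<in> states N - (states N - R n) \<Longrightarrow> \<sigma> s = \<sigma>' (Some s)"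
    using K.extend_positional[OF \<sigma>'(1)] by blast
  have "\<sigma> s = \<sigma>' (Some s)" if "s \<in> R n" for s
    using that \<sigma>(2) reach_within_subset[OF s0, of n] by blast
  from escape_prob_slice_le[OF \<sigma>'(1) \<sigma>(1) this] show ?thesis
    using \<sigma>(1) \<sigma>'(2) \<tau>(2) by (intro bexI[of _ \<sigma>]) auto
qed

lemma slice_inf_upper:
  assumes \<sigma>: "\<sigma> \<in> Positional N"
  shows "opt_prob OptInf (K n) (Some s0) (reaches {Some g, None})
    \<le> path_prob N (sched_of \<sigma>) s0 (reaches ({g} \<union> (states N - R n)))"
proof -
  obtain \<sigma>' where \<sigma>': "\<sigma>' \<in> Positional (K n)" "\<And>s. \<sigma>' (Some s) = \<sigma> s"
    using K.restrict_positional[OF \<sigma>] by blast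
  have "opt_prob OptInf (K n) (Some s0) (reaches {Some g, None})
      \<le> path_prob (K n) (sched_of \<sigma>') (Some s0) (reaches {Some g, None})"
    by (rule opt_prob_Inf_lower[OF K.valid_N sched_of_in_Sched[OF \<sigma>'(1)] start(2)])
  also have "\<dots> \<le> path_prob N (sched_of \<sigma>) s0 (reaches ({g} \<union> (states N - R n)))"
    by (rule escape_prob_slice_le[OF \<sigma>'(1) \<sigma>]) (simp add: \<sigma>'(2))
  finally show ?thesis .
qed

text \<open>A path of length at most \<open>n\<close> from \<open>s0\<close> does not notice the slicing.\<close>

lemma slice_lower:
  assumes \<tau>: "\<tau> \<in> Sched (K n)"
    and u1: "\<And>k. u k g \<le> (1 :: ennreal)" and u0: "\<And>x. x \<in> states N \<Longrightarrow> x \<noteq> g \<Longrightarrow> u 0 x = 0"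
    and u: "\<And>k h x a. last h = Some x \<Longrightarrow> x \<in> states N \<Longrightarrow> x \<noteq> g \<Longrightarrow>
      a \<in> set_pmf (\<tau> h) \<Longrightarrow> a \<in> enabled N x \<Longrightarrow> u (Suc k) x \<le> avg N x a (u k)"
  shows "u n s0 \<le> ennreal (path_prob (K n) \<tau> (Some s0) (reaches {Some g}))"
proof -
  \<comment> \<open>With \<open>k\<close> steps left, a path from \<open>s0\<close> is in layer
    \<open>n - k\<close>, so \<open>u\<close> is kept only there. The default 0 at the sink and
    elsewhere makes the required inequality trivial.\<close>
  define f where "f k = case_option 0 (\<lambda>x. if x \<in> R (n - k) then u k x else 0)" for k
  have "f n (last [Some s0]) \<le> reach_val (K n) \<tau> {Some g} n [Some s0]"
  proof (rule reach_val_lower[where n = n])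
    fix k s assume "s \<in> {Some g}"
    then show "f k s \<le> 1" using u1 by (simp add: f_def)
  next
    fix s assume "s \<in> states (K n)" "s \<notin> {Some g}"
    then show "f 0 s = 0" using u0 by (auto simp: f_def K.states_N)
  next
    fix k h a
    assume k: "k < n" and h: "h \<noteq> []" "set h \<subseteq> states (K n)" "last h \<notin> {Some g}"
      and a: "a \<in> set_pmf (\<tau> h)"
    have l: "last h \<in> states (K n)" using h by auto
    have en: "a \<in> enabled (K n) (last h)" using \<tau> h a by (auto simp: Sched_def)
    then have aN: "a \<in> acts N" using enabled_in_acts K.acts_N by metis
    show "f (Suc k) (last h) \<le> avg (K n) (last h) a (f k)"
    proof (cases "\<exists>x. last h = Some x \<and> x \<in> R (n - Suc k)")
      case False
      then show ?thesis by (auto simp: f_def split: option.split)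
    next
      case True
      then obtain x where x: "last h = Some x" "x \<in> R (n - Suc k)" by blast
      have xN: "x \<in> states N" using x(2) reach_within_subset[OF s0] by blast
      have "x \<in> R n" using x(2) reach_within_mono[of "n - Suc k" n N s0] by auto
      then have "a \<in> enabled N x" using en xN x(1) K.enabled_Some[of x n] by simp
      then have "u (Suc k) x \<le> avg N x a (u k)" using x h a xN by (intro u[of h]) auto
      moreover have "f (Suc k) (last h) = u (Suc k) x" using x by (simp add: f_def)
      ultimately have "f (Suc k) (last h) \<le> avg N x a (u k)" by simp
      also have "\<dots> \<le> avg N x a (\<lambda>s'. if s' \<in> states N - R n then f k None else f k (Some s'))"
      proof (rule avg_mono)
        \<comment> \<open>A successor of layer \<open>n - Suc k\<close> lies in layer
          \<open>n - k\<close>, hence in layer \<open>n\<close>, and the sink branch never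
          arises.\<close>
        fix s' assume s': "s' \<in> states N" "0 < tr N x a s'"
        have "s' \<in> R (Suc (n - Suc k))" by (rule reach_within_step[OF x(2) s'(1) aN s'(2)])
        then have "s' \<in> R (n - k)" using k by (simp only: Suc_diff_Suc)
        moreover have "R (n - k) \<subseteq> R n" by (rule reach_within_mono) simp
        ultimately show "u k s' \<le> (if s' \<in> states N - R n then f k None else f k (Some s'))"
          by (auto simp: f_def)
      qed
      also have "\<dots> = avg (K n) (last h) a (f k)" unfolding x(1) by (rule K.avg_Some[OF xN aN, symmetric])
      finally show ?thesis .
    qed
  qed (use start in auto)
  also have "\<dots> \<le> ennreal (path_prob (K n) \<tau> (Some s0) (reaches {Some g}))"
    unfolding path_prob_reaches[OF K.valid_N \<tau> start(2)] by (rule SUP_upper) simp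
  finally show ?thesis by (simp add: f_def)
qed

lemma slice_sup_lower:
  assumes \<sigma>: "\<sigma> \<in> Positional N"
  shows "pos_val N \<sigma> {g} n s0 \<le> ennreal (opt_prob OptSup (K n) (Some s0) (reaches {Some g}))"
proof -
  obtain \<sigma>' where \<sigma>': "\<sigma>' \<in> Positional (K n)" "\<And>s. \<sigma>' (Some s) = \<sigma> s"
    using K.restrict_positional[OF \<sigma>] by blast
  have "pos_val N \<sigma> {g} n s0 \<le> ennreal (path_prob (K n) (sched_of \<sigma>') (Some s0) (reaches {Some g}))"
    by (rule slice_lower[where u = "pos_val N \<sigma> {g}", OF sched_of_in_Sched[OF \<sigma>'(1)]])
      (auto simp: pos_val_target sched_of_def \<sigma>'(2))
  also have "\<dots> \<le> ennreal (opt_prob OptSup (K n) (Some s0) (reaches {Some g}))"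
    by (intro ennreal_leI opt_prob_Sup_upper[OF K.valid_N sched_of_in_Sched[OF \<sigma>'(1)] start(2)])
  finally show ?thesis .
qed

text \<open>The order of choices matters: first the limit \<open>\<rho>\<close>, then
  \<open>m\<close> and \<open>k\<close> depending on \<open>\<rho>\<close> alone, and last an
  \<open>n\<close> beyond both at which \<open>\<sigma> n\<close> agrees with \<open>\<rho>\<close>
  on the finite layer \<open>m\<close>.\<close>

lemma sup_converges:
  assumes A: "\<And>\<sigma>. \<sigma> \<in> Positional N \<Longrightarrow> path_prob N (sched_of \<sigma>) s0 (reaches ({g} \<union> A \<sigma>)) = 1"
    "\<And>\<sigma>. \<sigma> \<in> Positional N \<Longrightarrow>
      path_prob N (sched_of \<sigma>) s0 (\<lambda>\<omega>. diverges N s0 \<omega> \<and> reaches (A \<sigma>) \<omega>) = 0"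
    and \<epsilon>: "0 < \<epsilon>"
  shows "\<exists>n. opt_prob OptSup (K n) (Some s0) (reaches {Some g, None})
    \<le> opt_prob OptSup (K n) (Some s0) (reaches {Some g}) + \<epsilon>"
proof -
  let ?E = "\<lambda>\<sigma> m. path_prob N (sched_of \<sigma>) s0 (reaches ({g} \<union> (states N - R m)))"
  have "\<forall>n. \<exists>\<sigma>\<in>Positional N.
      opt_prob OptSup (K n) (Some s0) (reaches {Some g, None}) \<le> ?E \<sigma> n + \<epsilon> / 3"
    using slice_sup_upper[of "\<epsilon> / 3"] \<epsilon> by simp
  then obtain \<sigma> where \<sigma>: "\<And>n. \<sigma> n \<in> Positional N"
    "\<And>n. opt_prob OptSup (K n) (Some s0) (reaches {Some g, None}) \<le> ?E (\<sigma> n) n + \<epsilon> / 3"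
    by metis
  obtain \<rho> where \<rho>: "\<rho> \<in> Positional N" and lim:
    "\<And>F. finite F \<Longrightarrow> F \<subseteq> states N \<Longrightarrow> infinite {n. \<forall>s\<in>F. tr N s (\<sigma> n s) = tr N s (\<rho> s)}"
    using limit_positional[OF N rows, of \<sigma>] \<sigma>(1) by blast
  let ?p = "path_prob N (sched_of \<rho>) s0 (reaches {g})"
  have p0: "0 \<le> ?p" by (rule path_prob_bounds(1)[OF N sched_of_in_Sched[OF \<rho>] s0])
  have "(\<lambda>m. ?E \<rho> m) \<longlonglongrightarrow> ?p" by (rule tendsto_escape_prob[OF N \<rho> s0 A(1,2)[OF \<rho>]])
  moreover have "?p < ?p + \<epsilon> / 3" using \<epsilon> by simp
  ultimately have "\<forall>\<^sub>F m in sequentially. ?E \<rho> m < ?p + \<epsilon> / 3" by (rule order_tendstoD(2))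
  then obtain m where m: "?E \<rho> m < ?p + \<epsilon> / 3" by (auto simp: eventually_sequentially)
  have "ennreal ?p \<le> (SUP k. pos_val N \<rho> {g} k s0)" by (simp add: path_prob_positional[OF N \<rho> s0])
  then obtain k where k: "\<And>n. k \<le> n \<Longrightarrow> ennreal (?p - \<epsilon> / 3) \<le> pos_val N \<rho> {g} n s0"
    using ennreal_SUP_approx[OF incseq_pos_val, of ?p N \<rho> "{g}" s0 "\<epsilon> / 3"] \<epsilon> by auto
  have "finite (R m)" by (rule finite_reach_within[OF N rows supp s0])
  then have "infinite {n. \<forall>s\<in>R m. tr N s (\<sigma> n s) = tr N s (\<rho> s)}"
    by (rule lim[OF _ reach_within_subset[OF s0]])
  then obtain n where n: "max m k < n" "\<And>s. s \<in> R m \<Longrightarrow> tr N s (\<sigma> n s) = tr N s (\<rho> s)"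
    unfolding infinite_nat_iff_unbounded by blast
  have "opt_prob OptSup (K n) (Some s0) (reaches {Some g, None}) \<le> ?E (\<sigma> n) n + \<epsilon> / 3"
    by (rule \<sigma>(2))
  \<comment> \<open>Leaving the larger layer \<open>n\<close> entails leaving layer
    \<open>m\<close>.\<close>
  also have "?E (\<sigma> n) n \<le> ?E (\<sigma> n) m"
    by (rule path_prob_reaches_mono[OF N sched_of_in_Sched[OF \<sigma>(1)] s0])
      (use reach_within_mono[of m n N s0] n(1) in auto)
  also have "?E (\<sigma> n) m = ?E \<rho> m"
    by (rule path_prob_cong_rows[OF N \<sigma>(1) \<rho> s0]) (use n(2) in auto)
  finally have upper: "opt_prob OptSup (K n) (Some s0) (reaches {Some g, None}) \<le> ?E \<rho> m + \<epsilon> / 3"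
    by simp
  have "ennreal (?p - \<epsilon> / 3) \<le> pos_val N \<rho> {g} n s0" using k n(1) by simp
  also note slice_sup_lower[OF \<rho>, of n]
  finally have "ennreal (?p - \<epsilon> / 3) \<le> ennreal (opt_prob OptSup (K n) (Some s0) (reaches {Some g}))" .
  moreover have "0 \<le> opt_prob OptSup (K n) (Some s0) (reaches {Some g})"
    using opt_prob_Sup_upper[OF K.valid_N _ start(2), of _ n "reaches {Some g}"]
      path_prob_bounds(1)[OF K.valid_N _ start(2)] Sched_nonempty[OF K.valid_N[of n]]
    by (meson all_not_in_conv order_trans)
  ultimately have "?p - \<epsilon> / 3 \<le> opt_prob OptSup (K n) (Some s0) (reaches {Some g})"
    by (simp add: ennreal_le_iff)
  then show ?thesis using upper m by (intro exI[of _ n]) linarith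
qed

end

section \<open>Convergence\<close>

lemma opt_prob_Inf_nonneg:
  assumes "valid_mdp M" "s \<in> states M"
  shows "0 \<le> opt_prob OptInf M s \<phi>"
  unfolding opt_prob.simps
  by (rule cINF_greatest[OF Sched_nonempty[OF assms(1)]]) (rule path_prob_bounds(1)[OF assms(1) _ assms(2)])

lemma le_opt_prob_Inf:
  assumes M: "valid_mdp M" "s \<in> states M"
    and c: "\<And>\<sigma>. \<sigma> \<in> Sched M \<Longrightarrow> c \<le> ennreal (path_prob M \<sigma> s \<phi>)"
  shows "c \<le> ennreal (opt_prob OptInf M s \<phi>)"
proof -
  obtain \<sigma> where \<sigma>: "\<sigma> \<in> Sched M" using Sched_nonempty[OF M(1)] by blast
  obtain r where r: "c = ennreal r" "0 \<le> r"
    using c[OF \<sigma>] by (cases c) (auto simp: top_unique)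
  have "r \<le> opt_prob OptInf M s \<phi>"
    unfolding opt_prob.simps
  proof (rule cINF_greatest[OF Sched_nonempty[OF M(1)]])
    fix \<sigma> assume \<sigma>: "\<sigma> \<in> Sched M"
    show "r \<le> path_prob M \<sigma> s \<phi>"
      using c[OF \<sigma>] path_prob_bounds(1)[OF M(1) \<sigma> M(2)] by (simp add: r)
  qed
  then show ?thesis by (simp add: r ennreal_leI)
qed

text \<open>Value iteration stays below every scheduler, hence below the infimum, which is 0 here.
  Collapsing therefore preserves the iteration when the sink gets value 0.\<close>

lemma min_val_Avoid:
  assumes M: "valid_mdp M" and s: "s \<in> Avoid_opt OptInf M G"
  shows "min_val M {G} k s = 0"
proof -
  have sM: "s \<in> states M" using s by (simp add: Avoid_opt_def)
  have "min_val M {G} k s \<le> ennreal (opt_prob OptInf M s (reaches {G}))"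
  proof (rule le_opt_prob_Inf[OF M sM])
    fix \<sigma> assume \<sigma>: "\<sigma> \<in> Sched M"
    note min_val_le_reach_val[OF \<sigma> sM]
    also have "reach_val M \<sigma> {G} k [s] \<le> ennreal (path_prob M \<sigma> s (reaches {G}))"
      unfolding path_prob_reaches[OF M \<sigma> sM] by (rule SUP_upper) simp
    finally show "min_val M {G} k s \<le> ennreal (path_prob M \<sigma> s (reaches {G}))" .
  qed
  then show ?thesis using s by (simp add: Avoid_opt_def)
qed

lemma Avoid_sched_subset_Inf:
  assumes M: "valid_mdp M" and \<sigma>: "\<sigma> \<in> Positional M"
  shows "Avoid_sched \<sigma> M G \<subseteq> Avoid_opt OptInf M G"
proof
  fix s assume s: "s \<in> Avoid_sched \<sigma> M G"
  then have sM: "s \<in> states M" by (simp add: Avoid_sched_def)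
  have "opt_prob OptInf M s (reaches {G}) \<le> 0"
    using opt_prob_Inf_lower[OF M sched_of_in_Sched[OF \<sigma>] sM, of "reaches {G}"] s
    by (simp add: Avoid_sched_def)
  then show "s \<in> Avoid_opt OptInf M G"
    using opt_prob_Inf_nonneg[OF M sM, of "reaches {G}"] sM by (simp add: Avoid_opt_def)
qed

lemma reaches_Un: "reaches (A \<union> B) = (\<lambda>\<omega>. reaches A \<omega> \<or> reaches B \<omega>)"
  by (auto simp: reaches_def fun_eq_iff)

theorem theorem6:
  fixes M :: "('s, 'a) mdp" and G s0 :: 's and opt :: optimum
  assumes "valid_mdp M"
    and "G \<in> states M" and "absorbing M G"
    and "s0 \<in> states M - Avoid_opt opt M G"
    and "finitely_branching M"
    and "univ_decisive M G s0"
    and "non_fleeing M G s0"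
  shows "\<forall>\<epsilon>>0. \<exists>n. \<bar>q_plus opt M G s0 n - q_minus opt M G s0 n\<bar> \<le> \<epsilon>"
proof (intro allI impI)
  fix \<epsilon> :: real assume \<epsilon>: "0 < \<epsilon>"
  note M = assms(1) and s0 = assms(4)
  have supp: "finite_support M"
    using assms(5) by (simp add: finitely_branching_def finite_support_def)
  have rows: "finite_rows M"
    using assms(5) by (simp add: finitely_branching_def finite_rows_def)
  have acts: "acts M \<noteq> {}"
    using M s0 by (auto simp: valid_mdp_def enabled_def)
  define N where "N = collapse opt M G"
  interpret C: sink M "Avoid_opt opt M G" N
    unfolding N_def by (rule sink_collapse[OF M supp acts])
  interpret S: sliced N "Some s0" "Some G"
    by unfold_locales
      (use C.valid_N C.finite_rows_N[OF rows] C.finite_support_N C.acts_N acts s0 C.Some_in_N in auto)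
  have s0N: "Some s0 \<in> states N" by (rule S.s0)
  have q: "q_minus opt M G s0 n = opt_prob opt (S.K n) (Some (Some s0)) (reaches {Some (Some G)})"
    "q_plus opt M G s0 n = opt_prob opt (S.K n) (Some (Some s0)) (reaches {Some (Some G), None})" for n
    by (simp_all add: q_minus_def q_plus_def approx_mdp_def N_def)
  have le: "q_minus opt M G s0 n \<le> q_plus opt M G s0 n" for n
    unfolding q by (rule opt_prob_reaches_mono[OF S.K.valid_N S.start(2)]) auto
  have dec: "path_prob M (sched_of \<sigma>) s0 (reaches ({G} \<union> Avoid_sched \<sigma> M G)) = 1"
    if "\<sigma> \<in> Positional M" for \<sigma>
    using assms(6) that unfolding univ_decisive_def reaches_Un by blast
  \<comment> \<open>By monotonicity in the target only one direction of the absolute value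
    remains.\<close>
  have "\<exists>n. q_plus opt M G s0 n \<le> q_minus opt M G s0 n + \<epsilon>"
  proof (cases opt)
    case OptSup
    note opt = this
    have "path_prob N (sched_of \<sigma>) (Some s0) (reaches ({Some G} \<union> Avoid_sched \<sigma> N (Some G))) = 1"
      if \<sigma>: "\<sigma> \<in> Positional N" for \<sigma>
    proof -
      obtain \<sigma>' where \<sigma>': "\<sigma>' \<in> Positional M"
        "\<And>s. s \<in> states M - Avoid_opt opt M G \<Longrightarrow> \<sigma>' s = \<sigma> (Some s)"
        using C.extend_positional[OF \<sigma>] by blast
      \<comment> \<open>Decisiveness passes to the collapse: a surviving state that avoids
        \<open>G\<close> in \<open>M\<close> still does in \<open>N\<close>, and collapsed states
        become the sink, which avoids \<open>G\<close> as well.\<close>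
      have "path_prob M (sched_of \<sigma>') s0 (reaches ({G} \<union> Avoid_sched \<sigma>' M G))
          \<le> path_prob N (sched_of \<sigma>) (Some s0) (reaches ({Some G} \<union> Avoid_sched \<sigma> N (Some G)))"
      proof (rule C.path_prob_sink_ge[OF \<sigma> \<sigma>' _ _ s0])
        fix s assume s: "s \<in> states M - Avoid_opt opt M G" "s \<in> {G} \<union> Avoid_sched \<sigma>' M G"
        have "path_prob N (sched_of \<sigma>) (Some s) (reaches {Some G})
            \<le> path_prob M (sched_of \<sigma>') s (reaches {G})"
          by (rule C.path_prob_sink_le[OF \<sigma> \<sigma>' _ _ s(1)]) auto
        moreover have "0 \<le> path_prob N (sched_of \<sigma>) (Some s) (reaches {Some G})"
          using s C.Some_in_N by (intro path_prob_bounds(1)[OF C.valid_N sched_of_in_Sched[OF \<sigma>]]) auto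
        ultimately show "Some s \<in> {Some G} \<union> Avoid_sched \<sigma> N (Some G)"
          using s C.Some_in_N by (auto simp: Avoid_sched_def)
      next
        have "ennreal (path_prob N (sched_of \<sigma>) None (reaches {Some G})) = 0"
          unfolding path_prob_positional[OF C.valid_N \<sigma> C.None_in_N] by (simp add: C.pos_val_None)
        then show "None \<in> {Some G} \<union> Avoid_sched \<sigma> N (Some G)"
          using C.None_in_N path_prob_bounds(1)[OF C.valid_N sched_of_in_Sched[OF \<sigma>] C.None_in_N]
          by (simp add: Avoid_sched_def ennreal_eq_0_iff antisym)
      qed
      then show ?thesis
        using dec[OF \<sigma>'(1)] path_prob_bounds(2)[OF C.valid_N sched_of_in_Sched[OF \<sigma>] s0N]
        by (simp add: antisym)
    qed
    moreover have "path_prob N (sched_of \<sigma>) (Some s0)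
        (\<lambda>\<omega>. diverges N (Some s0) \<omega> \<and> reaches (Avoid_sched \<sigma> N (Some G)) \<omega>) = 0"
      if "\<sigma> \<in> Positional N" for \<sigma>
      using assms(7) that by (simp add: non_fleeing_def Let_def N_def opt)
    ultimately show ?thesis
      using S.sup_converges[of "\<lambda>\<sigma>. Avoid_sched \<sigma> N (Some G)" \<epsilon>] \<epsilon> unfolding q unfolding opt by blast
  next
    case OptInf
    note opt = this
    obtain \<sigma> where \<sigma>: "\<sigma> \<in> Positional M"
      "\<And>s k. s \<in> states M \<Longrightarrow> pos_val M \<sigma> {G} k s \<le> (SUP k. min_val M {G} k s)"
      using min_val_positional[OF M rows] by blast
    let ?p = "path_prob M (sched_of \<sigma>) s0 (reaches {G})"
    obtain \<sigma>' where \<sigma>': "\<sigma>' \<in> Positional N" "\<And>s. \<sigma>' (Some s) = \<sigma> s"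
      using C.restrict_positional[OF \<sigma>(1)] by blast
    \<comment> \<open>States from which \<open>\<sigma>\<close> avoids \<open>G\<close> have infimum
      0 and are collapsed, so decisiveness yields almost sure arrival at \<open>G\<close> or the
      sink.\<close>
    have "path_prob M (sched_of \<sigma>) s0 (reaches ({G} \<union> Avoid_sched \<sigma> M G))
        \<le> path_prob N (sched_of \<sigma>') (Some s0) (reaches ({Some G} \<union> {None}))"
      by (rule C.path_prob_sink_ge[OF \<sigma>'(1) \<sigma>(1) _ _ _ s0])
        (use \<sigma>'(2) Avoid_sched_subset_Inf[OF M \<sigma>(1)] opt in auto)
    then have "path_prob N (sched_of \<sigma>') (Some s0) (reaches ({Some G} \<union> {None})) = 1"
      using dec[OF \<sigma>(1)]
        path_prob_bounds(2)[OF C.valid_N sched_of_in_Sched[OF \<sigma>'(1)] s0N, of "reaches ({Some G} \<union> {None})"]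
      by linarith
    from tendsto_escape_prob[OF C.valid_N \<sigma>'(1) s0N this C.not_diverges_after_None[OF \<sigma>'(1) s0N]]
    have "(\<lambda>n. path_prob N (sched_of \<sigma>') (Some s0) (reaches ({Some G} \<union> (states N - S.R n))))
        \<longlonglongrightarrow> path_prob N (sched_of \<sigma>') (Some s0) (reaches {Some G})" .
    \<comment> \<open>Collapsing can only lose visits to \<open>G\<close>, so the limit of the
      escape probabilities is at most the value of \<open>\<sigma>\<close> in
      \<open>M\<close>.\<close>
    moreover have "path_prob N (sched_of \<sigma>') (Some s0) (reaches {Some G}) \<le> ?p"
      by (rule C.path_prob_sink_le[OF \<sigma>'(1) \<sigma>(1) _ _ _ s0]) (use \<sigma>'(2) in auto)
    then have "path_prob N (sched_of \<sigma>') (Some s0) (reaches {Some G}) < ?p + \<epsilon> / 2" using \<epsilon> by simp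
    ultimately have "\<forall>\<^sub>F n in sequentially.
        path_prob N (sched_of \<sigma>') (Some s0) (reaches ({Some G} \<union> (states N - S.R n))) < ?p + \<epsilon> / 2"
      by (rule order_tendstoD(2))
    then obtain m where m: "\<And>n. m \<le> n \<Longrightarrow>
        path_prob N (sched_of \<sigma>') (Some s0) (reaches ({Some G} \<union> (states N - S.R n))) < ?p + \<epsilon> / 2"
      by (auto simp: eventually_sequentially)
    have "ennreal ?p \<le> (SUP k. min_val M {G} k s0)"
      unfolding path_prob_positional[OF M \<sigma>(1) DiffD1[OF s0]] using \<sigma>(2) s0 by (intro SUP_least) auto
    then obtain k where k: "\<And>n. k \<le> n \<Longrightarrow> ennreal (?p - \<epsilon> / 2) \<le> min_val M {G} n s0"
      using ennreal_SUP_approx[OF incseq_min_val, of ?p M "{G}" s0 "\<epsilon> / 2"] \<epsilon> by auto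
    define n where "n = max m k"
    have "q_plus opt M G s0 n \<le> ?p + \<epsilon> / 2"
      using S.slice_inf_upper[OF \<sigma>'(1), of n] m[of n] unfolding q unfolding opt by (simp add: n_def)
    \<comment> \<open>The iteration of \<open>M\<close>, with 0 at the sink, is a lower bound for
      every scheduler of the slice, history-dependent or randomized.\<close>
    have "case_option 0 (min_val M {G} n) (Some s0)
        \<le> ennreal (opt_prob OptInf (S.K n) (Some (Some s0)) (reaches {Some (Some G)}))"
    proof (rule le_opt_prob_Inf[OF S.K.valid_N S.start(2)])
      fix \<tau> assume \<tau>: "\<tau> \<in> Sched (S.K n)"
      show "case_option 0 (min_val M {G} n) (Some s0)
          \<le> ennreal (path_prob (S.K n) \<tau> (Some (Some s0)) (reaches {Some (Some G)}))"
      proof (rule S.slice_lower[where u = "\<lambda>k. case_option 0 (min_val M {G} k)", OF \<tau>])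
        fix j h x a
        assume h: "last h = Some x" "x \<in> states N" "x \<noteq> Some G"
          and a: "a \<in> set_pmf (\<tau> h)" "a \<in> enabled N x"
        show "case_option 0 (min_val M {G} (Suc j)) x \<le> avg N x a (case_option 0 (min_val M {G} j))"
        proof (cases x)
          case (Some s)
          then have s: "s \<in> states M - Avoid_opt OptInf M G" "s \<noteq> G"
            using h C.Some_in_N opt by auto
          then have a': "a \<in> enabled M s" using a(2) C.enabled_Some[of s] Some opt by simp
          then have "min_val M {G} (Suc j) s \<le> avg M s a (min_val M {G} j)"
            using s(2) by (auto intro: INF_lower)
          \<comment> \<open>On collapsed states the iteration is 0, exactly the value given to the
            sink.\<close>
          also have "\<dots> = avg M s a (\<lambda>s'. if s' \<in> Avoid_opt opt M G
              then case_option 0 (min_val M {G} j) None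
              else case_option 0 (min_val M {G} j) (Some s'))"
            by (rule avg_cong) (simp add: min_val_Avoid[OF M] opt)
          also have "\<dots> = avg N (Some s) a (case_option 0 (min_val M {G} j))"
            by (rule C.avg_Some[symmetric]) (use s enabled_in_acts[OF a'] in auto)
          finally show ?thesis by (simp only: Some option.case)
        qed simp
      qed (auto simp: min_val_target indicator_def split: option.splits if_splits)
    qed
    then have "min_val M {G} n s0 \<le> ennreal (q_minus opt M G s0 n)" unfolding q unfolding opt by simp
    moreover have "ennreal (?p - \<epsilon> / 2) \<le> min_val M {G} n s0" by (rule k) (simp add: n_def)
    ultimately have "ennreal (?p - \<epsilon> / 2) \<le> ennreal (q_minus opt M G s0 n)" by (rule order_trans[rotated])
    moreover have "0 \<le> q_minus opt M G s0 n"
      unfolding q unfolding opt by (rule opt_prob_Inf_nonneg[OF S.K.valid_N S.start(2)])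
    ultimately have "?p - \<epsilon> / 2 \<le> q_minus opt M G s0 n" by (simp add: ennreal_le_iff)
    then show ?thesis using \<open>q_plus opt M G s0 n \<le> ?p + \<epsilon> / 2\<close> by (intro exI[of _ n]) simp
  qed
  then obtain n where "q_plus opt M G s0 n \<le> q_minus opt M G s0 n + \<epsilon>" by blast
  then have "\<bar>q_plus opt M G s0 n - q_minus opt M G s0 n\<bar> \<le> \<epsilon>" using le[of n] by simp
  then show "\<exists>n. \<bar>q_plus opt M G s0 n - q_minus opt M G s0 n\<bar> \<le> \<epsilon>" ..
qed

end
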